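(* Let $(E,T,S,e)$ be a conditional expectation preserving system. Then $(E,T,S,e)$ is ergodic if and only if the following condition holds: $L_{S}f=Tf$ for all $f\in L^{1}(T)$.
   Context: A conditional Riesz triple $(E,e,T)$ consists of a Dedekind complete Riesz space $E$, an order weak unit $e$ of $E$, and a conditional expectation operator $T$ on $E$, that is, a strictly positive order continuous linear projection $T:E\to E$ with $Te=e$ and Dedekind complete range $R(T)$. A conditional expectation preserving system is a 4-tuple $(E,T,S,e)$ where $(E,e,T)$ is a conditional Riesz triple and $S:E\to E$ is an order continuous Riesz homomorphism with $Se=e$ and $TSf=Tf$ for all $f\in E$. The system is called ergodic if, for every $f\in E$, $Sf=f$ implies $Tf=f$. Let $E^u$ be the universal completion of $E$. The natural domain of $T$ is $L^1(T)=D-D$, where $D$ is the set of $x\in E^u_+$ for which there is a net $(x_\alpha)$ in $E_+$ with $0\le x_\alpha\uparrow x$ and $(Tx_\alpha)$ order bounded in $E^u$. The conditional expectation $T$ is extended to $L^1(T)$ by $Tx=\sup_\alpha Tx_\alpha$ for $x\in D$ with $(x_\alpha)$ such a net, and by linearity; the extension is again denoted $T$. The map $S$ has a unique extension to an order continuous Riesz homomorphism on $L^1(T)$, again denoted $S$, given by $Sx=\sup_\alpha Sx_\alpha$ whenever $x_\alpha\in E_+$ and $x_\alpha\uparrow x\in L^1(T)_+$, and by $Sf=Sf^+-Sf^-$ for general $f\in L^1(T)$; it satisfies $TS=T$ on $L^1(T)$. For $f\in L^1(T)$ and $n\in\mathbb{N}$ put $S_nf:=\frac1n\sum_{k=0}^{n-1}S^kf\in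 L^1(T)$; $L_Sf$ denotes the order limit in $L^1(T)$ of the sequence $(S_nf)$ as $n\to\infty$, when this limit exists. The condition $L_Sf=Tf$ includes the existence of this order limit.
   Formalization: The order limit L_S f is taken as a limit in the universal completion E^u that lies in L^1(T); with dominating nets required inside L^1(T) the claim fails, e.g. for a Bernoulli shift and an integrable f of one coordinate with E[f log^+ f] infinite. *)

theory Defs
  imports Complex_Main "HOL-Library.Lattice_Algebras"
begin

section \<open>Riesz spaces\<close>

class riesz_space = ordered_real_vector + lattice_ab_group_add_abs

class dedekind_complete_riesz_space = riesz_space + conditionally_complete_lattice

text \<open>\<open>is_sup_in L A s\<close>: \<open>s\<close> is the supremum of \<open>A\<close> in \<open>L\<close> with the order induced on \<open>L\<close>.\<close>

definition is_sup_in :: "'a::order set \<Rightarrow> 'a set \<Rightarrow> 'a \<Rightarrow> bool" where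
  "is_sup_in L A s \<longleftrightarrow> s \<in> L \<and> (\<forall>a\<in>A. a \<le> s) \<and> (\<forall>u\<in>L. (\<forall>a\<in>A. a \<le> u) \<longrightarrow> s \<le> u)"

definition dedekind_complete_on :: "'a::order set \<Rightarrow> bool" where
  "dedekind_complete_on L \<longleftrightarrow>
     (\<forall>A. A \<subseteq> L \<longrightarrow> A \<noteq> {} \<longrightarrow> (\<exists>u\<in>L. \<forall>a\<in>A. a \<le> u) \<longrightarrow> (\<exists>s. is_sup_in L A s))"

text \<open>
  A Dedekind complete Riesz space is universally complete if it is also laterally complete: every
  set of pairwise disjoint positive elements has a supremum.
\<close>

class universally_complete_riesz_space = dedekind_complete_riesz_space +
  assumes laterally_complete:
    "A \<noteq> {} \<Longrightarrow> (\<forall>x\<in>A. 0 \<le> x) \<Longrightarrow> pairwise (\<lambda>x y. inf x y = 0) A \<Longrightarrow>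
     \<exists>s. (\<forall>x\<in>A. x \<le> s) \<and> (\<forall>u. (\<forall>x\<in>A. x \<le> u) \<longrightarrow> s \<le> u)"

definition up_directed :: "'a::order set \<Rightarrow> bool" where
  "up_directed A \<longleftrightarrow> A \<noteq> {} \<and> (\<forall>x\<in>A. \<forall>y\<in>A. \<exists>z\<in>A. x \<le> z \<and> y \<le> z)"

definition down_directed :: "'a::order set \<Rightarrow> bool" where
  "down_directed A \<longleftrightarrow> A \<noteq> {} \<and> (\<forall>x\<in>A. \<forall>y\<in>A. \<exists>z\<in>A. z \<le> x \<and> z \<le> y)"

text \<open>
  Order convergence of the net \<open>X\<close> to \<open>x\<close>: there is a net \<open>y\<^sub>\<beta> \<down> 0\<close> such that for every \<open>\<beta>\<close>
  eventually \<open>\<bar>X i - x\<bar> \<le> y\<^sub>\<beta>\<close>. The monotone net \<open>(y\<^sub>\<beta>)\<close> is represented by its range, a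
  downward directed set (which conversely is a decreasing net indexed by itself), and the index set
  of \<open>X\<close> by its filter of tails.
\<close>

definition order_converges :: "('i \<Rightarrow> 'a::riesz_space) \<Rightarrow> 'a \<Rightarrow> 'i filter \<Rightarrow> bool" where
  "order_converges X x F \<longleftrightarrow>
     (\<exists>Y. down_directed Y \<and> (\<forall>y\<in>Y. 0 \<le> y) \<and> (\<forall>l. (\<forall>y\<in>Y. l \<le> y) \<longrightarrow> l \<le> 0) \<and>
          (\<forall>y\<in>Y. \<forall>\<^sub>F i in F. \<bar>X i - x\<bar> \<le> y))"

text \<open>
  A net in the domain order converges exactly if the identity order converges along the image of its
  tail filter, so quantifying over filters on the domain covers nets with arbitrary index sets.
\<close>

definition order_continuous :: "('a::riesz_space \<Rightarrow> 'b::riesz_space) \<Rightarrow> bool" where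
  "order_continuous R \<longleftrightarrow>
     (\<forall>F x. order_converges (\<lambda>y. y) x F \<longrightarrow> order_converges R (R x) F)"

definition riesz_hom :: "('a::riesz_space \<Rightarrow> 'b::riesz_space) \<Rightarrow> bool" where
  "riesz_hom R \<longleftrightarrow> linear R \<and> (\<forall>x y. R (sup x y) = sup (R x) (R y)) \<and>
     (\<forall>x y. R (inf x y) = inf (R x) (R y))"

definition weak_unit :: "'a::riesz_space \<Rightarrow> bool" where
  "weak_unit e \<longleftrightarrow> 0 \<le> e \<and> (\<forall>x. inf \<bar>x\<bar> e = 0 \<longrightarrow> x = 0)"


section \<open>Conditional expectation preserving systems\<close>

definition conditional_riesz_triple ::
    "'a::dedekind_complete_riesz_space \<Rightarrow> ('a \<Rightarrow> 'a) \<Rightarrow> bool" where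
  "conditional_riesz_triple e T \<longleftrightarrow>
     weak_unit e \<and>
     linear T \<and> (\<forall>x. T (T x) = T x) \<and>
     (\<forall>x>0. T x > 0) \<and> order_continuous T \<and>
     T e = e \<and> dedekind_complete_on (range T)"

definition ce_preserving_system ::
    "('a::dedekind_complete_riesz_space \<Rightarrow> 'a) \<Rightarrow> ('a \<Rightarrow> 'a) \<Rightarrow> 'a \<Rightarrow> bool" where
  "ce_preserving_system T S e \<longleftrightarrow>
     conditional_riesz_triple e T \<and>
     riesz_hom S \<and> order_continuous S \<and> S e = e \<and> (\<forall>f. T (S f) = T f)"

definition ergodic :: "('a::dedekind_complete_riesz_space \<Rightarrow> 'a) \<Rightarrow> ('a \<Rightarrow> 'a) \<Rightarrow> bool" where
  "ergodic T S \<longleftrightarrow> (\<forall>f. S f = f \<longrightarrow> T f = f)"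


section \<open>The natural domain of the conditional expectation\<close>

text \<open>
  The universal completion of \<open>E\<close> is, up to Riesz isomorphism, the unique universally complete Riesz
  space containing \<open>E\<close> as an order dense Riesz subspace. The map \<open>j\<close> is the inclusion.
\<close>

definition universal_completion ::
    "('a::riesz_space \<Rightarrow> 'u::universally_complete_riesz_space) \<Rightarrow> bool" where
  "universal_completion j \<longleftrightarrow>
     riesz_hom j \<and> inj j \<and> (\<forall>y>0. \<exists>x>0. j x \<le> y)"

text \<open>\<open>increases_to j A x\<close>: the range \<open>A\<close> of a net in \<open>E\<^sub>+\<close> with \<open>0 \<le> x\<^sub>\<alpha> \<up> x\<close> in the universal
  completion.\<close>

definition increases_to ::
    "('a::riesz_space \<Rightarrow> 'u::riesz_space) \<Rightarrow> 'a set \<Rightarrow> 'u \<Rightarrow> bool" where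
  "increases_to j A x \<longleftrightarrow> (\<forall>a\<in>A. 0 \<le> a) \<and> up_directed A \<and> is_sup_in UNIV (j ` A) x"

definition L1_cone ::
    "('a::riesz_space \<Rightarrow> 'u::riesz_space) \<Rightarrow> ('a \<Rightarrow> 'a) \<Rightarrow> 'u set" where
  "L1_cone j T =
     {x. 0 \<le> x \<and> (\<exists>A. increases_to j A x \<and> bdd_below (j ` T ` A) \<and> bdd_above (j ` T ` A))}"

definition L1 ::
    "('a::riesz_space \<Rightarrow> 'u::riesz_space) \<Rightarrow> ('a \<Rightarrow> 'a) \<Rightarrow> 'u set" where
  "L1 j T = {u - v |u v. u \<in> L1_cone j T \<and> v \<in> L1_cone j T}"

text \<open>
  \<open>sup_ext j R x\<close> is \<open>sup\<^sub>\<alpha> R x\<^sub>\<alpha>\<close> for any net \<open>x\<^sub>\<alpha> \<up> x\<close> in \<open>E\<^sub>+\<close>; for the operators and arguments used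
  below this supremum exists and does not depend on the net.
\<close>

definition sup_ext ::
    "('a::riesz_space \<Rightarrow> 'u::riesz_space) \<Rightarrow> ('a \<Rightarrow> 'a) \<Rightarrow> 'u \<Rightarrow> 'u" where
  "sup_ext j R x = (THE y. \<exists>A. increases_to j A x \<and> is_sup_in UNIV (j ` R ` A) y)"

definition T_ext ::
    "('a::riesz_space \<Rightarrow> 'u::riesz_space) \<Rightarrow> ('a \<Rightarrow> 'a) \<Rightarrow> 'u \<Rightarrow> 'u" where
  "T_ext j T f =
     (THE y. \<exists>u\<in>L1_cone j T. \<exists>v\<in>L1_cone j T. f = u - v \<and> y = sup_ext j T u - sup_ext j T v)"

definition S_ext ::
    "('a::riesz_space \<Rightarrow> 'u::riesz_space) \<Rightarrow> ('a \<Rightarrow> 'a) \<Rightarrow> 'u \<Rightarrow> 'u" where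
  "S_ext j S f = sup_ext j S (sup f 0) - sup_ext j S (sup (- f) 0)"

definition cesaro ::
    "('a::riesz_space \<Rightarrow> 'u::riesz_space) \<Rightarrow> ('a \<Rightarrow> 'a) \<Rightarrow> nat \<Rightarrow> 'u \<Rightarrow> 'u" where
  "cesaro j S n f = (1 / real n) *\<^sub>R (\<Sum>k<n. (S_ext j S ^^ k) f)"

text \<open>
  \<open>has_LS j T S f g\<close>: the order limit \<open>L\<^sub>S f\<close> exists in \<open>L\<^sup>1(T)\<close> and equals \<open>g\<close>. The limit is an
  element of \<open>L\<^sup>1(T)\<close>, while the order convergence is, like the suprema above, that of the universal
  completion: the net dominating \<open>\<bar>S\<^sub>n f - g\<bar>\<close> need not lie in \<open>L\<^sup>1(T)\<close>. Already for the expectation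
  on \<open>L\<^sup>1\<close> of a probability space, ergodic averages of an integrable function converge almost
  everywhere, but in general have no integrable majorant.
\<close>

definition has_LS ::
    "('a::riesz_space \<Rightarrow> 'u::riesz_space) \<Rightarrow> ('a \<Rightarrow> 'a) \<Rightarrow> ('a \<Rightarrow> 'a) \<Rightarrow> 'u \<Rightarrow> 'u \<Rightarrow> bool" where
  "has_LS j T S f g \<longleftrightarrow> g \<in> L1 j T \<and> order_converges (\<lambda>n. cesaro j S n f) g sequentially"

end

theory Submission
  imports Defs
begin

text \<open>
  Suppose the system is ergodic. For \<open>f \<in> E\<close> and \<open>\<epsilon> > 0\<close>, the maxima \<open>G n\<close> of the Birkhoff sums of
  \<open>g = f - T f - \<epsilon> e\<close> satisfy \<open>G (n + 1) = (g + S (G n))\<^sup>+\<close>. The band on which they are unbounded is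
  invariant, and on it \<open>G (n + 1) - S (G n)\<close> decreases to \<open>g\<close>; applying \<open>T\<close> shows that it is trivial.
  Hence the averages of \<open>f\<close>, truncated at \<open>e\<close>, converge to \<open>T f\<close>. For \<open>f \<in> L\<^sup>1(T)\<^sub>+\<close> approximated from
  below by \<open>a \<in> E\<^sub>+\<close>, the maximal inequality \<open>\<delta> T (G n \<and> e) \<le> T b\<close> for \<open>g = b - \<delta> e\<close> controls the
  averages of \<open>f - a\<close>. This gives unbounded order convergence of the averages, which in the
  universally complete space is order convergence because bounds can be glued together along
  disjoint bands. Conversely, the averages of an invariant \<open>f \<in> E\<close> are constant.
\<close>

section \<open>Riesz spaces\<close>

text \<open>There are no points, indicators or products to argue with. Sets are represented by
  components of a weak unit, obtained as suprema of truncated multiples \<open>inf (k x) e\<close>,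
  and a pointwise case split becomes disjointness of positive and negative parts. Truncation at
  \<open>e\<close> also makes suprema of unbounded families exist. The second device is strict
  positivity. The positive part of a lower bound of truncated errors lies below \<open>j e\<close>;
  since E is an ideal of its universal completion, it is \<open>j z\<close> for some
  \<open>z\<close> in E, and \<open>T z \<le> 0\<close> forces \<open>z = 0\<close>. Hence for
  general integrable elements it is enough to control \<open>T\<close> of the truncated error, which
  is exactly what a maximal inequality offers. The slack \<epsilon> e is what makes
  \<open>T g = - \<epsilon> e\<close> strictly negative on every component of \<open>e\<close>.
  Subtracting \<open>T f + \<epsilon> e\<close> inside the averages requires
  \<open>S (T f) = T f\<close>. For a system this is not an assumption but the lemma
  \<open>S_T\<close>, where \<open>T (S f) = T f\<close> and strict positivity are exploited through
  a discretisation of the values of \<open>T f\<close>.\<close>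

abbreviation is_lub :: "'a::order set \<Rightarrow> 'a \<Rightarrow> bool" where
  "is_lub \<equiv> is_sup_in UNIV"

lemma is_lubI:
  "(\<And>a. a \<in> A \<Longrightarrow> a \<le> s) \<Longrightarrow> (\<And>u. (\<And>a. a \<in> A \<Longrightarrow> a \<le> u) \<Longrightarrow> s \<le> u) \<Longrightarrow> is_lub A s"
  unfolding is_sup_in_def by auto

lemma is_lub_upper: "is_lub A s \<Longrightarrow> a \<in> A \<Longrightarrow> a \<le> s"
  unfolding is_sup_in_def by auto

lemma is_lub_least: "is_lub A s \<Longrightarrow> (\<And>a. a \<in> A \<Longrightarrow> a \<le> u) \<Longrightarrow> s \<le> u"
  unfolding is_sup_in_def by auto

lemma is_lub_unique: "is_lub A s \<Longrightarrow> is_lub A t \<Longrightarrow> s = t"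
  by (meson antisym is_lub_least is_lub_upper)

lemma is_lub_singleton: "is_lub {a} a"
  by (rule is_lubI) auto

lemma scaleR_inf:
  fixes a b :: "'a::riesz_space"
  assumes "0 \<le> c"
  shows "c *\<^sub>R inf a b = inf (c *\<^sub>R a) (c *\<^sub>R b)"
proof (cases "c = 0")
  case False
  with assms have c: "c > 0" by simp
  have "(1/c) *\<^sub>R inf (c *\<^sub>R a) (c *\<^sub>R b) \<le> (1/c) *\<^sub>R (c *\<^sub>R a)"
       "(1/c) *\<^sub>R inf (c *\<^sub>R a) (c *\<^sub>R b) \<le> (1/c) *\<^sub>R (c *\<^sub>R b)"
    using c by (intro scaleR_left_mono; simp)+
  then have "(1/c) *\<^sub>R inf (c *\<^sub>R a) (c *\<^sub>R b) \<le> inf a b" using c by simp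
  then have "c *\<^sub>R ((1/c) *\<^sub>R inf (c *\<^sub>R a) (c *\<^sub>R b)) \<le> c *\<^sub>R inf a b"
    using c by (intro scaleR_left_mono) auto
  then have "inf (c *\<^sub>R a) (c *\<^sub>R b) \<le> c *\<^sub>R inf a b" using c by simp
  moreover have "c *\<^sub>R inf a b \<le> inf (c *\<^sub>R a) (c *\<^sub>R b)"
    using c by (simp add: scaleR_left_mono)
  ultimately show ?thesis by simp
qed simp

lemma pos_inf_neg:
  fixes z :: "'a::riesz_space"
  shows "inf (sup z 0) (sup (- z) 0) = 0"
proof -
  have 1: "sup z 0 = z + sup (- z) 0" by (simp add: add_sup_distrib_left sup_commute)
  have "inf (sup z 0) (sup (- z) 0) = sup (- z) 0 + inf z 0"
    unfolding 1 using add_inf_distrib_left[of "sup (- z) 0" z 0] by (simp add: add.commute)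
  also have "inf z 0 = - sup (- z) 0" by (simp only: neg_sup_eq_inf minus_minus minus_zero)
  finally show ?thesis by (simp only: add.right_inverse)
qed

lemma pos_diff_neg:
  fixes z :: "'a::riesz_space"
  shows "sup z 0 - sup (- z) 0 = z"
proof -
  have "sup z 0 = z + sup (- z) 0" by (simp add: add_sup_distrib_left sup_commute)
  then show ?thesis by (simp only: add_diff_cancel_right')
qed

text \<open>Replaces a case split on the sign of \<open>z\<close>: the two bounds live on disjoint
  parts, and multiples of disjoint elements stay disjoint. The factor \<open>k + 1\<close> dominates
  both \<open>k\<close> and 1.\<close>

lemma le_pos_le_neg_imp_nonpos:
  fixes z :: "'a::riesz_space"
  assumes "a \<le> k *\<^sub>R sup z 0" "a \<le> sup (- z) 0" "0 \<le> k"
  shows "a \<le> 0"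
proof -
  have "k *\<^sub>R sup z 0 \<le> (k+1) *\<^sub>R sup z 0" by (intro scaleR_right_mono) auto
  moreover have "1 *\<^sub>R sup (-z) 0 \<le> (k+1) *\<^sub>R sup (-z) 0"
    using assms(3) by (intro scaleR_right_mono) auto
  ultimately have "a \<le> inf ((k+1) *\<^sub>R sup z 0) ((k+1) *\<^sub>R sup (-z) 0)"
    using assms by (auto intro: order_trans)
  also have "\<dots> = (k+1) *\<^sub>R inf (sup z 0) (sup (-z) 0)"
    using assms(3) by (subst scaleR_inf) auto
  also have "\<dots> = 0" by (simp add: pos_inf_neg)
  finally show ?thesis .
qed

lemma inf_scaleR_nonpos:
  fixes a b :: "'a::riesz_space"
  assumes "inf a b \<le> 0" "0 \<le> a" "0 \<le> b" "0 \<le> k"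
  shows "inf (k *\<^sub>R a) b \<le> 0"
proof -
  have "inf (k *\<^sub>R a) (1 *\<^sub>R b) \<le> inf ((k+1) *\<^sub>R a) ((k+1) *\<^sub>R b)"
    by (intro inf_mono scaleR_right_mono) (use assms in auto)
  also have "\<dots> = (k+1) *\<^sub>R inf a b" by (rule scaleR_inf[symmetric]) (use assms in auto)
  also have "\<dots> \<le> (k+1) *\<^sub>R 0" by (rule scaleR_left_mono) (use assms in auto)
  finally show ?thesis by simp
qed

lemma inf_add_le:
  fixes x a b :: "'a::riesz_space"
  assumes "0 \<le> x" "0 \<le> a" "0 \<le> b"
  shows "inf (a + b) x \<le> inf a x + inf b x"
proof -
  define t where "t = inf (a+b) x"
  have t: "t \<le> a + b" "t \<le> x" by (auto simp: t_def)
  have "t - x \<le> inf b x"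
    by (rule order_trans[of _ 0]) (use t assms in simp_all)
  moreover have "t - a \<le> inf b x"
    using t assms by (auto simp: diff_le_eq add.commute add_increasing)
  ultimately have "sup (t - a) (t - x) \<le> inf b x" by simp
  moreover have "sup (t - a) (t - x) = t - inf a x"
    using add_sup_distrib_left[of t "- a" "- x"] by (simp add: diff_inf_eq_sup)
  ultimately have "t - inf a x \<le> inf b x" by (simp only:)
  then show ?thesis unfolding diff_le_eq by (simp only: t_def add.commute)
qed

text \<open>Where \<open>y > c w\<close>, the weight \<open>w\<close> is below \<open>y/c\<close>.\<close>

lemma scale_inf_pos_le:
  fixes y w :: "'a::riesz_space"
  assumes "0 \<le> y" "0 \<le> k" "0 \<le> c"
  shows "c *\<^sub>R inf (k *\<^sub>R sup (y - c *\<^sub>R w) 0) w \<le> y"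
proof -
  define u where "u = c *\<^sub>R inf (k *\<^sub>R sup (y - c *\<^sub>R w) 0) w - y"
  have "c *\<^sub>R inf (k *\<^sub>R sup (y - c *\<^sub>R w) 0) w \<le> c *\<^sub>R (k *\<^sub>R sup (y - c *\<^sub>R w) 0)"
    by (rule scaleR_left_mono) (use assms in auto)
  then have 1: "u \<le> (c * k) *\<^sub>R sup (y - c *\<^sub>R w) 0"
    using assms(1) by (simp add: u_def diff_le_eq add_increasing2)
  have "c *\<^sub>R inf (k *\<^sub>R sup (y - c *\<^sub>R w) 0) w \<le> c *\<^sub>R w"
    by (rule scaleR_left_mono) (use assms in auto)
  then have "u \<le> - (y - c *\<^sub>R w)" by (simp add: u_def)
  then have 2: "u \<le> sup (- (y - c *\<^sub>R w)) 0" by (rule le_supI1)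
  have "u \<le> 0" by (rule le_pos_le_neg_imp_nonpos[OF 1 2]) (use assms in auto)
  then show ?thesis by (simp add: u_def)
qed

lemma is_lub_add_const:
  fixes s :: "'a::riesz_space"
  assumes "is_lub X s"
  shows "is_lub ((\<lambda>x. x + c) ` X) (s + c)"
proof (rule is_lubI)
  fix u assume "\<And>a. a \<in> (\<lambda>x. x + c) ` X \<Longrightarrow> a \<le> u"
  then have "x \<le> u - c" if "x \<in> X" for x using that by (force simp: le_diff_eq)
  then have "s \<le> u - c" by (rule is_lub_least[OF assms])
  then show "s + c \<le> u" by (simp add: le_diff_eq)
qed (use is_lub_upper[OF assms] in auto)

lemma is_lub_scaleR:
  fixes s :: "'a::riesz_space"
  assumes "is_lub X s" "0 < c"
  shows "is_lub ((\<lambda>x. c *\<^sub>R x) ` X) (c *\<^sub>R s)"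
proof (rule is_lubI)
  fix a assume "a \<in> (\<lambda>x. c *\<^sub>R x) ` X"
  then show "a \<le> c *\<^sub>R s" using is_lub_upper[OF assms(1)] assms(2) by (auto intro: scaleR_left_mono)
next
  fix u assume u: "\<And>a. a \<in> (\<lambda>x. c *\<^sub>R x) ` X \<Longrightarrow> a \<le> u"
  have "x \<le> (1/c) *\<^sub>R u" if "x \<in> X" for x
    using scaleR_left_mono[of "c *\<^sub>R x" u "1/c"] u that assms(2) by simp
  then have "s \<le> (1/c) *\<^sub>R u" by (rule is_lub_least[OF assms(1)])
  from scaleR_left_mono[OF this, of c] show "c *\<^sub>R s \<le> u" using assms(2) by simp
qed

text \<open>Infinite distributivity needs no completeness:
  \<open>x = inf x c + (sup x c - c)\<close> bounds \<open>x\<close> by \<open>u\<close> plus a term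
  that is monotone in \<open>x\<close>, so the supremum obeys the same bound.\<close>

lemma is_lub_inf:
  fixes s :: "'a::riesz_space"
  assumes "is_lub X s"
  shows "is_lub ((\<lambda>x. inf x c) ` X) (inf s c)"
proof (rule is_lubI)
  fix a assume "a \<in> (\<lambda>x. inf x c) ` X"
  then show "a \<le> inf s c" using is_lub_upper[OF assms] by (auto intro: le_infI1)
next
  fix u assume u: "\<And>a. a \<in> (\<lambda>x. inf x c) ` X \<Longrightarrow> a \<le> u"
  have "x \<le> u + (sup s c - c)" if "x \<in> X" for x
  proof -
    have "x = inf x c + (sup x c - c)"
      using add_eq_inf_sup[of x c] by (simp add: algebra_simps)
    also have "\<dots> \<le> u + (sup s c - c)"
      using u that is_lub_upper[OF assms that] by (intro add_mono diff_right_mono sup_mono) auto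
    finally show ?thesis .
  qed
  then have "s \<le> u + (sup s c - c)" by (rule is_lub_least[OF assms])
  moreover have "s = inf s c + (sup s c - c)"
    using add_eq_inf_sup[of s c] by (simp add: algebra_simps)
  ultimately have "inf s c + (sup s c - c) \<le> u + (sup s c - c)" by simp
  then show "inf s c \<le> u" by simp
qed

lemma is_lub_add_Times:
  fixes f g :: "_ \<Rightarrow> 'a::riesz_space"
  assumes f: "is_lub (f ` A) x" and g: "is_lub (g ` B) y"
  shows "is_lub ((\<lambda>(a, b). f a + g b) ` (A \<times> B)) (x + y)"
proof (rule is_lubI)
  fix c assume "c \<in> (\<lambda>(a, b). f a + g b) ` (A \<times> B)"
  then show "c \<le> x + y" using is_lub_upper[OF f] is_lub_upper[OF g] by (auto intro!: add_mono)
next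
  fix u assume u: "\<And>c. c \<in> (\<lambda>(a, b). f a + g b) ` (A \<times> B) \<Longrightarrow> c \<le> u"
  have *: "f a + g b \<le> u" if "a \<in> A" "b \<in> B" for a b
    using that by (intro u) force
  have "f a \<le> u - y" if "a \<in> A" for a
  proof -
    have "y \<le> u - f a" using *[OF that]
      by (intro is_lub_least[OF g]) (auto simp: le_diff_eq add.commute)
    then show ?thesis by (simp add: le_diff_eq add.commute)
  qed
  then have "x \<le> u - y" by (intro is_lub_least[OF f]) auto
  then show "x + y \<le> u" by (simp add: le_diff_eq)
qed

lemma is_lub_add:
  fixes f g :: "'b::order \<Rightarrow> 'a::riesz_space"
  assumes A: "up_directed A" and f: "is_lub (f ` A) x" and g: "is_lub (g ` A) y"
    and mono: "\<And>a b. a \<in> A \<Longrightarrow> b \<in> A \<Longrightarrow> a \<le> b \<Longrightarrow> f a \<le> f b"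
      "\<And>a b. a \<in> A \<Longrightarrow> b \<in> A \<Longrightarrow> a \<le> b \<Longrightarrow> g a \<le> g b"
  shows "is_lub ((\<lambda>a. f a + g a) ` A) (x + y)"
proof (rule is_lubI)
  fix c assume "c \<in> (\<lambda>a. f a + g a) ` A"
  then show "c \<le> x + y" using is_lub_upper[OF f] is_lub_upper[OF g] by (auto intro!: add_mono)
next
  fix u assume u: "\<And>c. c \<in> (\<lambda>a. f a + g a) ` A \<Longrightarrow> c \<le> u"
  show "x + y \<le> u"
  proof (rule is_lub_least[OF is_lub_add_Times[OF f g]])
    fix d assume "d \<in> (\<lambda>(a, b). f a + g b) ` (A \<times> A)"
    then obtain a b where ab: "a \<in> A" "b \<in> A" "d = f a + g b" by auto
    obtain c where c: "c \<in> A" "a \<le> c" "b \<le> c" using A ab unfolding up_directed_def by blast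
    have "d \<le> f c + g c" unfolding ab(3) using mono c ab by (intro add_mono) auto
    also have "\<dots> \<le> u" using u c by auto
    finally show "d \<le> u" .
  qed
qed

lemma is_lub_diff_dn:
  fixes s :: "'a::riesz_space"
  assumes "is_lub A s" "\<And>a. a \<in> A \<Longrightarrow> l \<le> s - a"
  shows "l \<le> 0"
proof -
  have "s \<le> s - l"
    by (rule is_lub_least[OF assms(1)]) (use assms(2) in \<open>force simp: le_diff_eq add.commute\<close>)
  then show ?thesis by simp
qed

subsection \<open>Dedekind complete Riesz spaces\<close>

lemma is_lub_Sup:
  fixes A :: "'a::dedekind_complete_riesz_space set"
  shows "A \<noteq> {} \<Longrightarrow> bdd_above A \<Longrightarrow> is_lub A (Sup A)"
  by (intro is_lubI) (auto intro: cSup_upper cSup_least)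

text \<open>The multiples of \<open>x\<close> are shifted into themselves by adding
  \<open>x\<close>, so their supremum \<open>s\<close> satisfies
  \<open>s \<le> s - x\<close>.\<close>

lemma archimedean:
  fixes x y :: "'a::dedekind_complete_riesz_space"
  assumes "\<And>n::nat. real n *\<^sub>R x \<le> y"
  shows "x \<le> 0"
proof -
  define A where "A = range (\<lambda>n::nat. real n *\<^sub>R x)"
  have lub: "is_lub A (Sup A)"
    unfolding A_def by (rule is_lub_Sup) (use assms in \<open>auto intro!: bdd_aboveI[of _ y]\<close>)
  have "Sup A \<le> Sup A - x"
  proof (rule is_lub_least[OF lub])
    fix a assume "a \<in> A"
    then obtain n where n: "a = real n *\<^sub>R x" by (auto simp: A_def)
    have "real (Suc n) *\<^sub>R x \<le> Sup A"
      unfolding A_def by (rule is_lub_upper[OF lub[unfolded A_def]]) (rule rangeI)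
    then show "a \<le> Sup A - x" by (simp add: n le_diff_eq algebra_simps)
  qed
  then show ?thesis by simp
qed

lemma archimedean_div:
  fixes x y b :: "'a::dedekind_complete_riesz_space"
  assumes "\<And>m::nat. N \<le> m \<Longrightarrow> m > 0 \<Longrightarrow> x \<le> y + (1 / real m) *\<^sub>R b" and "0 \<le> b"
  shows "x \<le> y"
proof -
  have "real n *\<^sub>R (x - y) \<le> b" for n :: nat
  proof -
    define m where "m = max (Suc n) N"
    have m: "m > 0" "N \<le> m" "n \<le> m" by (auto simp: m_def)
    have "x - y \<le> (1 / real m) *\<^sub>R b" using assms(1)[of m] m by (simp add: diff_le_eq add.commute)
    then have "real n *\<^sub>R (x - y) \<le> real n *\<^sub>R ((1 / real m) *\<^sub>R b)"
      by (rule scaleR_left_mono) auto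
    also have "\<dots> = (real n / real m) *\<^sub>R b" by simp
    also have "\<dots> \<le> 1 *\<^sub>R b" using assms(2) m by (intro scaleR_right_mono) auto
    finally show ?thesis by simp
  qed
  then have "x - y \<le> 0" by (rule archimedean)
  then show ?thesis by simp
qed

lemma archimedean_eps:
  fixes x y b :: "'a::dedekind_complete_riesz_space"
  assumes "\<And>\<epsilon>::real. 0 < \<epsilon> \<Longrightarrow> x \<le> y + \<epsilon> *\<^sub>R b" and "0 \<le> b"
  shows "x \<le> y"
  by (rule archimedean_div[of 0]) (use assms in auto)

lemma weak_unit_pos: "weak_unit w \<Longrightarrow> 0 \<le> w"
  unfolding weak_unit_def by blast

lemma weak_unitD: "weak_unit w \<Longrightarrow> 0 \<le> x \<Longrightarrow> inf x w \<le> 0 \<Longrightarrow> x = 0"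
  unfolding weak_unit_def by (metis abs_of_nonneg inf.bounded_iff order_antisym)

text \<open>The excess \<open>d\<close> of \<open>x\<close> over an upper bound lies below every
  \<open>sup (x - n w) 0\<close>, that is, where \<open>x > n w\<close>. There \<open>n w\<close> is
  at most \<open>x\<close>, so \<open>n (inf d w) \<le> x\<close> for all \<open>n\<close>, and
  \<open>d\<close> is disjoint from the weak unit.\<close>

lemma weak_unit_is_lub:
  fixes x w :: "'a::dedekind_complete_riesz_space"
  assumes "weak_unit w" "0 \<le> x"
  shows "is_lub (range (\<lambda>n::nat. inf x (real n *\<^sub>R w))) x"
proof (rule is_lubI)
  fix v assume v: "\<And>a. a \<in> range (\<lambda>n::nat. inf x (real n *\<^sub>R w)) \<Longrightarrow> a \<le> v"
  define d where "d = sup (x - v) 0"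
  have d: "d \<le> sup (x - real n *\<^sub>R w) 0" for n :: nat
  proof -
    have "inf x (real n *\<^sub>R w) \<le> v" using v by blast
    then have "x - v \<le> x - inf x (real n *\<^sub>R w)" by (rule diff_left_mono)
    also have "\<dots> = sup (x - real n *\<^sub>R w) 0"
      using add_sup_distrib_left[of x "- x" "- (real n *\<^sub>R w)"]
      by (simp add: diff_inf_eq_sup sup_commute)
    finally show ?thesis by (simp add: d_def)
  qed
  have "inf d w \<le> 0 + (1 / real n) *\<^sub>R x" if "n > 0" for n :: nat
  proof -
    have "inf d w \<le> inf (1 *\<^sub>R sup (x - real n *\<^sub>R w) 0) w" using d by (intro inf_mono) auto
    then have "real n *\<^sub>R inf d w \<le> real n *\<^sub>R inf (1 *\<^sub>R sup (x - real n *\<^sub>R w) 0) w"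
      by (rule scaleR_left_mono) auto
    also have "\<dots> \<le> x" by (rule scale_inf_pos_le) (use assms in auto)
    finally have "real n *\<^sub>R inf d w \<le> x" .
    from scaleR_left_mono[OF this, of "1 / real n"] that show ?thesis by simp
  qed
  then have "inf d w \<le> 0" by (rule archimedean_div) (use assms in auto)
  then have "d = 0" by (intro weak_unitD[OF assms(1)]) (auto simp: d_def)
  then have "x - v \<le> 0" by (metis d_def sup.cobounded1)
  then show "x \<le> v" by simp
qed auto

text \<open>Indicators are recognised by stability under doubling and truncating: a function with
  values in [0, 1] satisfying \<open>min (2 c) 1 \<le> c\<close> takes only the values 0 and
  1.\<close>

lemma le_component_imp_disjoint:
  fixes c w :: "'a::riesz_space"
  assumes "inf (2 *\<^sub>R c) w \<le> c"
  shows "inf c (w - c) \<le> 0"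
proof -
  have "inf c (w - c) + c = inf (2 *\<^sub>R c) w"
    by (simp add: add_inf_distrib_right scaleR_2)
  then show ?thesis using assms by (metis add_le_same_cancel2)
qed

subsection \<open>Boundedness in universally complete Riesz spaces\<close>

text \<open>
  Think of \<open>c (Suc m)\<close> as the indicator of the set where \<open>sup X > m\<close>. The differences \<open>d m\<close> are
  disjoint and exhaust \<open>w\<close>, and \<open>X\<close> is bounded by \<open>m\<close> on \<open>d m\<close>; lateral completeness glues these
  bounds together.
\<close>

lemma universally_complete_bdd_above:
  fixes X :: "'u::universally_complete_riesz_space set"
  assumes w: "weak_unit w" and pos: "\<And>x. x \<in> X \<Longrightarrow> 0 \<le> x"
    and small: "\<And>l. (\<And>m::nat. m > 0 \<Longrightarrow> l \<le> Sup ((\<lambda>x. inf ((1 / real m) *\<^sub>R x) w) ` X)) \<Longrightarrow> l \<le> 0"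
  shows "bdd_above X"
proof (cases "X = {}")
  case False
  have w0: "0 \<le> w" by (rule weak_unit_pos[OF w])
  \<comment> \<open>As \<open>k\<close> grows, the truncated multiples increase to the component of
    \<open>w\<close> on which \<open>x > m w\<close>; this avoids band projections. Letting
    \<open>k\<close> run through all naturals makes the family stable under doubling, as
    \<open>c_comp\<close> requires.\<close>
  define F where
    "F m = (\<lambda>(x, k). inf (real k *\<^sub>R sup (x - real m *\<^sub>R w) 0) w) ` (X \<times> (UNIV :: nat set))" for m :: nat
  define c where "c m = (case m of 0 \<Rightarrow> w | Suc m \<Rightarrow> Sup (F m))" for m
  have c0: "c 0 = w" and cS: "c (Suc m) = Sup (F m)" for m by (auto simp: c_def)
  have lubF: "is_lub (F m) (c (Suc m))" for m
    unfolding cS by (rule is_lub_Sup) (use False in \<open>auto simp: F_def intro!: bdd_aboveI[of _ w]\<close>)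
  have FI: "inf (real k *\<^sub>R sup (x - real m *\<^sub>R w) 0) w \<in> F m" if "x \<in> X" for x k m
    using that unfolding F_def by force
  have FE: "\<exists>x k. x \<in> X \<and> a = inf (real k *\<^sub>R sup (x - real m *\<^sub>R w) 0) w" if "a \<in> F m" for a m
    using that unfolding F_def by force
  have c_le: "c m \<le> w" for m
  proof (cases m)
    case (Suc m')
    show ?thesis unfolding Suc by (rule is_lub_least[OF lubF]) (use FE in fastforce)
  qed (simp add: c0)
  have c_pos: "0 \<le> c m" for m
  proof (cases m)
    case (Suc m')
    obtain x where x: "x \<in> X" using False by auto
    have "0 \<le> inf (real 1 *\<^sub>R sup (x - real m' *\<^sub>R w) 0) w" using w0 by auto
    also have "\<dots> \<le> c m" unfolding Suc using is_lub_upper[OF lubF FI[OF x]] .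
    finally show ?thesis .
  qed (use w0 c0 in auto)
  have c_comp: "inf (2 *\<^sub>R c m) w \<le> c m" for m
  proof (cases m)
    case (Suc m')
    have "is_lub ((\<lambda>x. inf x w) ` ((\<lambda>x. 2 *\<^sub>R x) ` F m')) (inf (2 *\<^sub>R c m) w)"
      unfolding Suc by (intro is_lub_inf is_lub_scaleR lubF) auto
    then show ?thesis
    proof (rule is_lub_least)
      fix a assume "a \<in> (\<lambda>x. inf x w) ` ((\<lambda>x. 2 *\<^sub>R x) ` F m')"
      then obtain x k where x: "x \<in> X"
        and a: "a = inf (2 *\<^sub>R inf (real k *\<^sub>R sup (x - real m' *\<^sub>R w) 0) w) w"
        using FE by blast
      have "2 *\<^sub>R inf (real k *\<^sub>R sup (x - real m' *\<^sub>R w) 0) w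
          \<le> 2 *\<^sub>R (real k *\<^sub>R sup (x - real m' *\<^sub>R w) 0)"
        by (rule scaleR_left_mono) auto
      also have "\<dots> = real (2 * k) *\<^sub>R sup (x - real m' *\<^sub>R w) 0" by simp
      finally have "a \<le> inf (real (2 * k) *\<^sub>R sup (x - real m' *\<^sub>R w) 0) w"
        unfolding a by (rule inf_mono) auto
      also have "\<dots> \<le> c m" unfolding Suc using is_lub_upper[OF lubF FI[OF x]] .
      finally show "a \<le> c m" .
    qed
  qed (simp add: c0)
  have c_disj: "inf (c m) (w - c m) \<le> 0" for m by (rule le_component_imp_disjoint[OF c_comp])
  have c_step: "c (Suc m) \<le> c m" for m
  proof (cases m)
    case (Suc m')
    show ?thesis
    proof (rule is_lub_least[OF lubF])
      fix a assume "a \<in> F m"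
      then obtain x k where x: "x \<in> X" and a: "a = inf (real k *\<^sub>R sup (x - real m *\<^sub>R w) 0) w"
        using FE by blast
      have "a \<le> inf (real k *\<^sub>R sup (x - real m' *\<^sub>R w) 0) w"
        unfolding a Suc using w0
        by (intro inf_mono scaleR_left_mono sup_mono diff_left_mono scaleR_right_mono) auto
      also have "\<dots> \<le> c m" unfolding Suc using is_lub_upper[OF lubF FI[OF x]] .
      finally show "a \<le> c m" .
    qed
  qed (use c_le c0 in auto)
  have c_dec: "m \<le> n \<Longrightarrow> c n \<le> c m" for m n by (rule lift_Suc_antimono_le[of c, OF c_step])
  \<comment> \<open>Where \<open>x > m w\<close>, the weight \<open>w\<close> is below
    \<open>x / m\<close>, so \<open>c (Suc m)\<close> is dominated by the supremum occurring in
    \<open>small\<close>.\<close>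
  have c_null: "l \<le> 0" if l: "\<And>m. l \<le> c m" for l
  proof (rule small)
    fix m :: nat assume m: "m > 0"
    have lub: "is_lub ((\<lambda>x. inf ((1 / real m) *\<^sub>R x) w) ` X) (Sup ((\<lambda>x. inf ((1 / real m) *\<^sub>R x) w) ` X))"
      by (rule is_lub_Sup) (use False in \<open>auto intro!: bdd_aboveI[of _ w]\<close>)
    have "c (Suc m) \<le> Sup ((\<lambda>x. inf ((1 / real m) *\<^sub>R x) w) ` X)"
    proof (rule is_lub_least[OF lubF])
      fix a assume "a \<in> F m"
      then obtain x k where x: "x \<in> X" and a: "a = inf (real k *\<^sub>R sup (x - real m *\<^sub>R w) 0) w"
        using FE by blast
      have "real m *\<^sub>R a \<le> x" unfolding a by (rule scale_inf_pos_le) (use pos x in auto)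
      from scaleR_left_mono[OF this, of "1 / real m"] have "a \<le> (1 / real m) *\<^sub>R x" using m by simp
      then have "a \<le> inf ((1 / real m) *\<^sub>R x) w" unfolding a by simp
      also have "\<dots> \<le> Sup ((\<lambda>x. inf ((1 / real m) *\<^sub>R x) w) ` X)" using is_lub_upper[OF lub] x by blast
      finally show "a \<le> \<dots>" .
    qed
    with l[of "Suc m"] show "l \<le> Sup ((\<lambda>x. inf ((1 / real m) *\<^sub>R x) w) ` X)" by (rule order_trans)
  qed
  define d where "d m = c m - c (Suc m)" for m
  have d_pos: "0 \<le> d m" for m using c_step by (simp add: d_def)
  have d_le1: "d m \<le> c m" for m using c_pos by (simp add: d_def)
  have d_le2: "d m \<le> w - c (Suc m)" for m using c_le by (simp add: d_def)
  have d_disj0: "inf (d i) (d j) \<le> 0" if "i < j" for i j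
  proof -
    have "d j \<le> c (Suc i)" using d_le1[of j] c_dec[of "Suc i" j] that by auto
    then have "inf (d i) (d j) \<le> inf (c (Suc i)) (w - c (Suc i))"
      using d_le2[of i] by (auto intro: le_infI1 le_infI2)
    then show ?thesis using c_disj order_trans by blast
  qed
  have d_disj: "inf (d i) (d j) \<le> 0" if "i \<noteq> j" for i j
    using d_disj0[of i j] d_disj0[of j i] that by (cases "i < j") (auto simp: inf_commute)
  define A where "A = range (\<lambda>m. real m *\<^sub>R d m)"
  have "pairwise (\<lambda>x y. inf x y = 0) A"
  proof (rule pairwiseI)
    fix x y assume "x \<in> A" "y \<in> A" "x \<noteq> y"
    then obtain i k where ik: "x = real i *\<^sub>R d i" "y = real k *\<^sub>R d k" "i \<noteq> k" by (auto simp: A_def)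
    have "inf (real k *\<^sub>R d k) (d i) \<le> 0"
      by (rule inf_scaleR_nonpos) (use ik d_disj d_pos in auto)
    then have "inf (d i) y \<le> 0" unfolding ik by (simp add: inf_commute)
    then have "inf x y \<le> 0" unfolding ik(1)
      by (rule inf_scaleR_nonpos) (use ik d_pos in \<open>auto simp: scaleR_nonneg_nonneg\<close>)
    moreover have "0 \<le> inf x y" using ik d_pos by (auto simp: scaleR_nonneg_nonneg)
    ultimately show "inf x y = 0" by (rule antisym)
  qed
  moreover have "\<forall>x\<in>A. 0 \<le> x" using d_pos by (auto simp: A_def scaleR_nonneg_nonneg)
  ultimately obtain Z where Z: "\<forall>x\<in>A. x \<le> Z"
    using laterally_complete[of A] by (auto simp: A_def)
  have "x \<le> Z" if x: "x \<in> X" for x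
  proof -
    \<comment> \<open>The excess over \<open>Z\<close> is disjoint from each \<open>d m\<close>,
      because \<open>Z\<close> is at least \<open>m d m\<close> and \<open>x\<close> exceeds
      \<open>m w\<close> only on \<open>c (Suc m)\<close>. Removing the \<open>d m\<close> one after
      another leaves \<open>inf v w\<close> below every \<open>c m\<close>.\<close>
    define v where "v = sup (x - Z) 0"
    have v_d: "inf v (d m) \<le> 0" for m
    proof -
      define y where "y = sup (x - real m *\<^sub>R w) 0"
      have wd: "0 \<le> w - d m" using d_le1[of m] c_le[of m] by (simp add: order_trans)
      have "x - Z \<le> x - real m *\<^sub>R d m" using Z by (auto simp: A_def intro!: diff_left_mono)
      also have "\<dots> = (x - real m *\<^sub>R w) + real m *\<^sub>R (w - d m)" by (simp add: algebra_simps)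
      also have "\<dots> \<le> y + real m *\<^sub>R (w - d m)" by (simp add: y_def)
      finally have "v \<le> y + real m *\<^sub>R (w - d m)"
        using wd by (auto simp: v_def y_def scaleR_nonneg_nonneg)
      then have "inf v (d m) \<le> inf (y + real m *\<^sub>R (w - d m)) (d m)" by (intro inf_mono) auto
      also have "\<dots> \<le> inf y (d m) + inf (real m *\<^sub>R (w - d m)) (d m)"
        by (rule inf_add_le) (use d_pos wd in \<open>auto simp: y_def scaleR_nonneg_nonneg\<close>)
      also have "\<dots> \<le> 0 + 0"
      proof (rule add_mono)
        have "inf y w \<le> c (Suc m)" using is_lub_upper[OF lubF FI[OF x, of 1 m]] by (simp add: y_def)
        moreover have "inf y (d m) \<le> inf y w"
          using d_le1[of m] c_le[of m] by (auto intro: le_infI2)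
        ultimately have "inf y (d m) \<le> inf (c (Suc m)) (w - c (Suc m))"
          using d_le2[of m] by (meson inf.bounded_iff inf_le2 order_trans)
        then show "inf y (d m) \<le> 0" using c_disj order_trans by blast
        have "w - d m = (w - c m) + c (Suc m)" by (simp add: d_def)
        then have "inf (w - d m) (d m) = inf ((w - c m) + c (Suc m)) (d m)" by (simp only:)
        also have "\<dots> \<le> inf (w - c m) (d m) + inf (c (Suc m)) (d m)"
          by (rule inf_add_le) (use d_pos c_le c_pos in auto)
        also have "\<dots> \<le> inf (c m) (w - c m) + inf (c (Suc m)) (w - c (Suc m))"
          using d_le1[of m] d_le2[of m] by (intro add_mono) (auto intro: le_infI1 le_infI2)
        also have "\<dots> \<le> 0 + 0" by (intro add_mono c_disj)
        finally have "inf (w - d m) (d m) \<le> 0" by simp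
        then show "inf (real m *\<^sub>R (w - d m)) (d m) \<le> 0"
          by (rule inf_scaleR_nonpos) (use wd d_pos in auto)
      qed
      finally show ?thesis by simp
    qed
    have v_step: "inf v (c m) \<le> inf v (c (Suc m))" for m
    proof -
      have "inf v (c m) = inf (d m + c (Suc m)) v" by (simp add: d_def inf_commute)
      also have "\<dots> \<le> inf (d m) v + inf (c (Suc m)) v"
        by (rule inf_add_le) (use d_pos c_pos in \<open>auto simp: v_def\<close>)
      also have "\<dots> \<le> 0 + inf (c (Suc m)) v"
        using v_d[of m] by (intro add_mono) (auto simp: inf_commute)
      finally show ?thesis by (simp add: inf_commute)
    qed
    have "inf v (c 0) \<le> inf v (c m)" for m
      by (rule lift_Suc_mono_le[of "\<lambda>m. inf v (c m)"]) (use v_step in auto)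
    then have "inf v w \<le> c m" for m unfolding c0[symmetric] by (meson inf_le2 order_trans)
    then have "inf v w \<le> 0" by (rule c_null)
    then have "v = 0" by (intro weak_unitD[OF w]) (auto simp: v_def)
    then have "x - Z \<le> 0" by (metis v_def sup.cobounded1)
    then show ?thesis by simp
  qed
  then show ?thesis by (rule bdd_aboveI)
qed simp

subsection \<open>Order convergence\<close>

lemma order_converges_diff:
  fixes X Y :: "'i \<Rightarrow> 'a::riesz_space"
  assumes "order_converges X x F" "order_converges Y y F"
  shows "order_converges (\<lambda>i. X i - Y i) (x - y) F"
proof -
  obtain A where A: "down_directed A" "\<forall>a\<in>A. 0 \<le> a" "\<And>l. (\<forall>a\<in>A. l \<le> a) \<Longrightarrow> l \<le> 0"
    "\<forall>a\<in>A. \<forall>\<^sub>F i in F. \<bar>X i - x\<bar> \<le> a"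
    using assms(1) unfolding order_converges_def by blast
  obtain B where B: "down_directed B" "\<forall>a\<in>B. 0 \<le> a" "\<And>l. (\<forall>a\<in>B. l \<le> a) \<Longrightarrow> l \<le> 0"
    "\<forall>a\<in>B. \<forall>\<^sub>F i in F. \<bar>Y i - y\<bar> \<le> a"
    using assms(2) unfolding order_converges_def by blast
  let ?C = "(\<lambda>(a, b). a + b) ` (A \<times> B)"
  show ?thesis
    unfolding order_converges_def
  proof (intro exI[of _ ?C] conjI allI impI ballI)
    show "down_directed ?C"
      unfolding down_directed_def
    proof (intro conjI ballI)
      show "?C \<noteq> {}" using A(1) B(1) unfolding down_directed_def by auto
      fix p q assume "p \<in> ?C" "q \<in> ?C"
      then obtain a b a' b' where ab: "a \<in> A" "b \<in> B" "a' \<in> A" "b' \<in> B" "p = a + b" "q = a' + b'"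
        by auto
      obtain a'' where a'': "a'' \<in> A" "a'' \<le> a" "a'' \<le> a'"
        using A(1) ab unfolding down_directed_def by blast
      obtain b'' where b'': "b'' \<in> B" "b'' \<le> b" "b'' \<le> b'"
        using B(1) ab unfolding down_directed_def by blast
      show "\<exists>z\<in>?C. z \<le> p \<and> z \<le> q"
        using a'' b'' ab by (intro bexI[of _ "a'' + b''"]) (auto intro!: add_mono)
    qed
  next
    fix l assume l: "\<forall>c\<in>?C. l \<le> c"
    have "l - b \<le> 0" if "b \<in> B" for b
      using l that by (intro A(3)) (auto simp: diff_le_eq)
    then show "l \<le> 0" by (intro B(3)) auto
  next
    fix c assume "c \<in> ?C"
    then obtain a b where ab: "a \<in> A" "b \<in> B" "c = a + b" by auto
    have "\<forall>\<^sub>F i in F. \<bar>X i - x\<bar> \<le> a" "\<forall>\<^sub>F i in F. \<bar>Y i - y\<bar> \<le> b" using A(4) B(4) ab by auto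
    then show "\<forall>\<^sub>F i in F. \<bar>X i - Y i - (x - y)\<bar> \<le> c"
    proof eventually_elim
      case (elim i)
      have "\<bar>X i - Y i - (x - y)\<bar> = \<bar>(X i - x) - (Y i - y)\<bar>" by (simp add: algebra_simps)
      also have "\<dots> \<le> \<bar>X i - x\<bar> + \<bar>Y i - y\<bar>" by (rule abs_triangle_ineq4)
      also have "\<dots> \<le> a + b" using elim by (rule add_mono)
      finally show ?case using ab by simp
    qed
  qed (use A(2) B(2) in auto)
qed

lemma order_converges_eventually_const:
  assumes "order_converges X x F" "\<forall>\<^sub>F i in F. X i = y" "F \<noteq> bot"
  shows "x = y"
proof -
  obtain A where A: "\<And>l. (\<forall>a\<in>A. l \<le> a) \<Longrightarrow> l \<le> 0" "\<forall>a\<in>A. \<forall>\<^sub>F i in F. \<bar>X i - x\<bar> \<le> a"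
    using assms(1) unfolding order_converges_def by blast
  have "\<bar>y - x\<bar> \<le> a" if "a \<in> A" for a
  proof -
    have "\<forall>\<^sub>F i in F. \<bar>X i - x\<bar> \<le> a" using A(2) that by auto
    then have "\<forall>\<^sub>F i in F. \<bar>y - x\<bar> \<le> a" using assms(2) by eventually_elim auto
    then show ?thesis using assms(3) by (metis eventually_False eventually_mono)
  qed
  then have "\<bar>y - x\<bar> \<le> 0" using A(1) by blast
  then show ?thesis by simp
qed

text \<open>Convergence tested only after truncation at a weak unit is unbounded order convergence.
  The missing ingredient is a common bound for the errors; once it exists, tail suprema
  \<open>Y n\<close> can be formed without truncation, and the weak unit shows that their infimum
  vanishes.\<close>

lemma uo_imp_order_converges:
  fixes X :: "nat \<Rightarrow> 'u::universally_complete_riesz_space"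
  assumes w: "weak_unit w"
    and null: "\<And>l. (\<And>n. l \<le> Sup ((\<lambda>k. inf \<bar>X k - x\<bar> w) ` {n..})) \<Longrightarrow> l \<le> 0"
  shows "order_converges X x sequentially"
proof -
  define Z where "Z k = \<bar>X k - x\<bar>" for k
  have Z0: "0 \<le> Z k" for k by (simp add: Z_def)
  have w0: "0 \<le> w" by (rule weak_unit_pos[OF w])
  define q where "q n = Sup ((\<lambda>k. inf (Z k) w) ` {n..})" for n
  have q_lub: "is_lub ((\<lambda>k. inf (Z k) w) ` {n..}) (q n)" for n
    unfolding q_def by (rule is_lub_Sup) (auto intro!: bdd_aboveI[of _ w])
  have null: "l \<le> 0" if "\<And>n. l \<le> q n" for l
    using null[of l] that unfolding q_def Z_def by blast
  have q0: "0 \<le> q n" for n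
    using is_lub_upper[OF q_lub[of n], of "inf (Z n) w"] Z0[of n] w0
    by (meson atLeast_iff image_eqI inf.bounded_iff order_refl order_trans)
  have bdd: "bdd_above (range Z)"
  proof (rule universally_complete_bdd_above[OF w])
    fix l assume l: "\<And>m::nat. m > 0 \<Longrightarrow> l \<le> Sup ((\<lambda>x. inf ((1 / real m) *\<^sub>R x) w) ` range Z)"
    show "l \<le> 0"
    proof (rule null)
      fix n
      show "l \<le> q n"
      \<comment> \<open>Fix \<open>n\<close>: the tail from \<open>n\<close> on is bounded by
        \<open>q n\<close> for every \<open>m\<close>, while the finitely many earlier errors are
        bounded by their sum, which the factor \<open>1 / m\<close> makes negligible.\<close>
      proof (rule archimedean_div[of 0])
        show "0 \<le> sum Z {..<n}" using Z0 by (simp add: sum_nonneg)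
        fix m :: nat assume m: "m > 0"
        have "Sup ((\<lambda>x. inf ((1 / real m) *\<^sub>R x) w) ` range Z) \<le> q n + (1 / real m) *\<^sub>R sum Z {..<n}"
        proof (rule cSup_least)
          fix a assume "a \<in> (\<lambda>x. inf ((1 / real m) *\<^sub>R x) w) ` range Z"
          then obtain k where a: "a = inf ((1 / real m) *\<^sub>R Z k) w" by auto
          show "a \<le> q n + (1 / real m) *\<^sub>R sum Z {..<n}"
          proof (cases "k < n")
            case True
            have "sum Z {..<n} = Z k + sum Z ({..<n} - {k})"
              using True by (intro sum.remove) auto
            then have Zk: "Z k \<le> sum Z {..<n}" using Z0 by (simp add: sum_nonneg)
            have "a \<le> (1 / real m) *\<^sub>R Z k" by (simp add: a)
            also have "\<dots> \<le> (1 / real m) *\<^sub>R sum Z {..<n}"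
              using Zk by (intro scaleR_left_mono) auto
            finally show ?thesis using q0 by (simp add: add_increasing)
          next
            case False
            have "(1 / real m) *\<^sub>R Z k \<le> 1 *\<^sub>R Z k" using m Z0 by (intro scaleR_right_mono) auto
            then have "a \<le> inf (Z k) w" unfolding a by (intro inf_mono) auto
            also have "\<dots> \<le> q n" using False by (intro is_lub_upper[OF q_lub]) auto
            finally show ?thesis
              using Z0 by (simp add: add_increasing2 sum_nonneg scaleR_nonneg_nonneg)
          qed
        qed simp
        then show "l \<le> q n + (1 / real m) *\<^sub>R sum Z {..<n}" using l[OF m] order_trans by blast
      qed
    qed
  qed (use Z0 in auto)
  define Y where "Y n = Sup (Z ` {n..})" for n
  have Y_lub: "is_lub (Z ` {n..}) (Y n)" for n
    unfolding Y_def using bdd by (intro is_lub_Sup) (auto intro: bdd_above_mono)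
  have Z_le: "n \<le> k \<Longrightarrow> Z k \<le> Y n" for n k by (rule is_lub_upper[OF Y_lub]) auto
  have Y_dec: "n \<le> m \<Longrightarrow> Y m \<le> Y n" for n m by (rule is_lub_least[OF Y_lub]) (auto intro: Z_le)
  show ?thesis
    unfolding order_converges_def
  proof (intro exI[of _ "range Y"] conjI allI impI ballI)
    show "down_directed (range Y)"
      unfolding down_directed_def
    proof (intro conjI ballI)
      fix p r assume "p \<in> range Y" "r \<in> range Y"
      then obtain n m where "p = Y n" "r = Y m" by auto
      then show "\<exists>z\<in>range Y. z \<le> p \<and> z \<le> r"
        by (intro bexI[of _ "Y (max n m)"]) (auto intro: Y_dec)
    qed simp
  next
    fix y assume "y \<in> range Y"
    then obtain n where n: "y = Y n" by auto
    show "0 \<le> y" unfolding n using Z0 Z_le order_trans by blast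
    show "\<forall>\<^sub>F i in sequentially. \<bar>X i - x\<bar> \<le> y"
      unfolding n eventually_sequentially using Z_le unfolding Z_def by auto
  next
    fix l assume l: "\<forall>y\<in>range Y. l \<le> y"
    have "inf (sup l 0) w \<le> q n" for n
    proof -
      have "sup l 0 \<le> Y n" using l Z0 Z_le order_trans by (metis le_sup_iff order_refl rangeI)
      then have "inf (sup l 0) w \<le> inf (Y n) w" by (intro inf_mono) auto
      also have "\<dots> \<le> q n"
        by (rule is_lub_least[OF is_lub_inf[OF Y_lub]]) (auto intro: is_lub_upper[OF q_lub])
      finally show ?thesis .
    qed
    then have "inf (sup l 0) w \<le> 0" by (rule null)
    then have "sup l 0 = 0" by (intro weak_unitD[OF w]) auto
    then show "l \<le> 0" by (metis sup.cobounded1)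
  qed
qed

section \<open>Positive order continuous operators along directed sets\<close>

lemma up_directed_image:
  fixes f :: "'a::order \<Rightarrow> 'b::order"
  assumes "up_directed A" "\<And>x y. x \<in> A \<Longrightarrow> y \<in> A \<Longrightarrow> x \<le> y \<Longrightarrow> f x \<le> f y"
  shows "up_directed (f ` A)"
  unfolding up_directed_def
proof (intro conjI ballI)
  show "f ` A \<noteq> {}" using assms(1) unfolding up_directed_def by auto
  fix x y assume "x \<in> f ` A" "y \<in> f ` A"
  then obtain a b where ab: "a \<in> A" "b \<in> A" "x = f a" "y = f b" by auto
  then obtain c where "c \<in> A" "a \<le> c" "b \<le> c" using assms(1) unfolding up_directed_def by blast
  then show "\<exists>z\<in>f ` A. x \<le> z \<and> y \<le> z" using ab assms(2) by (intro bexI[of _ "f c"]) auto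
qed

lemma up_directed_range:
  fixes f :: "nat \<Rightarrow> 'a::order"
  assumes "\<And>m n. m \<le> n \<Longrightarrow> f m \<le> f n"
  shows "up_directed (range f)"
proof (rule up_directed_image)
  show "up_directed (UNIV :: nat set)"
    unfolding up_directed_def by (metis UNIV_I empty_iff max.cobounded1 max.cobounded2)
qed (rule assms)

locale positive_order_continuous =
  fixes R :: "'a::dedekind_complete_riesz_space \<Rightarrow> 'a"
  assumes lin: "linear R" and pos: "0 \<le> x \<Longrightarrow> 0 \<le> R x" and oc: "order_continuous R"
begin

lemma add: "R (x + y) = R x + R y" using lin by (rule linear_add)
lemma diff: "R (x - y) = R x - R y" using lin by (rule linear_diff)
lemma neg: "R (- x) = - R x" using lin by (rule linear_neg)
lemma scale: "R (c *\<^sub>R x) = c *\<^sub>R R x" using lin by (rule linear_scale)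
lemma zero: "R 0 = 0" using lin by (rule linear_0)
lemma mono: "x \<le> y \<Longrightarrow> R x \<le> R y" using pos[of "y - x"] by (simp add: diff)

lemma lub:
  assumes A: "up_directed A" and s: "is_lub A s"
  shows "is_lub (R ` A) (R s)"
proof -
  \<comment> \<open>The tail filter of \<open>A\<close> viewed as a net indexed by itself; this
    translates a directed supremum into the filter form of order continuity.\<close>
  define F where "F = (INF b\<in>A. principal {x\<in>A. b \<le> x})"
  have ev: "eventually P F \<longleftrightarrow> (\<exists>b\<in>A. \<forall>x\<in>A. b \<le> x \<longrightarrow> P x)" for P
    unfolding F_def
  proof (subst eventually_INF_base)
    show "A \<noteq> {}" using A unfolding up_directed_def by auto
    fix a b assume "a \<in> A" "b \<in> A"
    then obtain c where "c \<in> A" "a \<le> c" "b \<le> c" using A unfolding up_directed_def by blast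
    then show "\<exists>x\<in>A. principal {xa \<in> A. x \<le> xa} \<le> inf (principal {x \<in> A. a \<le> x}) (principal {x \<in> A. b \<le> x})"
      by (intro bexI[of _ c]) (auto intro: order_trans)
  qed (auto simp: eventually_principal)
  have "order_converges (\<lambda>y. y) s F"
    unfolding order_converges_def
  proof (intro exI[of _ "(\<lambda>a. s - a) ` A"] conjI allI impI ballI)
    show "down_directed ((\<lambda>a. s - a) ` A)"
      using A unfolding up_directed_def down_directed_def by (auto intro: diff_left_mono)
    show "0 \<le> y" if "y \<in> (\<lambda>a. s - a) ` A" for y using that is_lub_upper[OF s] by auto
    show "l \<le> 0" if "\<forall>y\<in>(\<lambda>a. s - a) ` A. l \<le> y" for l
      using that by (intro is_lub_diff_dn[OF s]) auto
    fix y assume "y \<in> (\<lambda>a. s - a) ` A"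
    then obtain b where b: "b \<in> A" "y = s - b" by auto
    have "\<bar>x - s\<bar> \<le> y" if x: "x \<in> A" "b \<le> x" for x
    proof -
      have "\<bar>x - s\<bar> = s - x" using is_lub_upper[OF s x(1)] by (simp add: abs_minus_commute[of x])
      then show ?thesis using x b by (simp add: diff_left_mono)
    qed
    then show "\<forall>\<^sub>F i in F. \<bar>i - s\<bar> \<le> y" unfolding ev using b(1) by blast
  qed
  then have "order_converges R (R s) F" using oc unfolding order_continuous_def by blast
  then obtain Y where Y: "\<And>l. (\<forall>y\<in>Y. l \<le> y) \<Longrightarrow> l \<le> 0" "\<forall>y\<in>Y. \<forall>\<^sub>F i in F. \<bar>R i - R s\<bar> \<le> y"
    unfolding order_converges_def by blast
  show ?thesis
  proof (rule is_lubI)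
    fix u assume u: "\<And>a. a \<in> R ` A \<Longrightarrow> a \<le> u"
    have "R s - u \<le> y" if y: "y \<in> Y" for y
    proof -
      obtain b where b: "b \<in> A" "\<bar>R b - R s\<bar> \<le> y" using Y(2) y unfolding ev by blast
      have "R s - u \<le> R s - R b" using u b by (intro diff_left_mono) auto
      also have "\<dots> \<le> \<bar>R b - R s\<bar>" by (metis abs_ge_self abs_minus_commute)
      finally show ?thesis using b by simp
    qed
    then have "R s - u \<le> 0" using Y(1) by blast
    then show "R s \<le> u" by simp
  qed (use is_lub_upper[OF s] mono in auto)
qed

end

section \<open>Ergodic averages in \<open>E\<close>\<close>

definition birkhoff_sum :: "('a::riesz_space \<Rightarrow> 'a) \<Rightarrow> nat \<Rightarrow> 'a \<Rightarrow> 'a" where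
  "birkhoff_sum S n f = (\<Sum>k<n. (S ^^ k) f)"

definition birkhoff_avg :: "('a::riesz_space \<Rightarrow> 'a) \<Rightarrow> nat \<Rightarrow> 'a \<Rightarrow> 'a" where
  "birkhoff_avg S n f = (1 / real n) *\<^sub>R birkhoff_sum S n f"

text \<open>The maximal function of Garsia's proof of the maximal ergodic theorem: for a Riesz
  homomorphism \<open>S\<close> it is the maximum of the Birkhoff sums of lengths 0 to
  \<open>n\<close>. The recursive form lets inductions run on monotonicity of \<open>S\<close>
  alone.\<close>

primrec hopf_max :: "('a::riesz_space \<Rightarrow> 'a) \<Rightarrow> nat \<Rightarrow> 'a \<Rightarrow> 'a" where
  "hopf_max S 0 g = 0"
| "hopf_max S (Suc n) g = sup 0 (g + S (hopf_max S n g))"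

locale ce_system =
  fixes T S :: "'a::dedekind_complete_riesz_space \<Rightarrow> 'a" and e :: 'a
  assumes system: "ce_preserving_system T S e"
begin

lemma e_unit: "weak_unit e"
  and T_e: "T e = e" and S_e: "S e = e" and T_T: "T (T x) = T x" and T_S: "T (S x) = T x"
  and S_sup: "S (sup x y) = sup (S x) (S y)" and S_inf: "S (inf x y) = inf (S x) (S y)"
  and T_strict: "0 < x \<Longrightarrow> 0 < T x"
  using system unfolding ce_preserving_system_def conditional_riesz_triple_def riesz_hom_def
  by simp_all

lemma e_pos: "0 \<le> e"
  by (rule weak_unit_pos[OF e_unit])

sublocale T: positive_order_continuous T
proof (rule positive_order_continuous.intro)
  show lin: "linear T" and "order_continuous T"
    using system unfolding ce_preserving_system_def conditional_riesz_triple_def by auto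
  show "0 \<le> T x" if "0 \<le> x" for x
    using that T_strict[of x] linear_0[OF lin] by (cases "x = 0") (auto simp: order_less_le)
qed

sublocale S: positive_order_continuous S
proof (rule positive_order_continuous.intro)
  show lin: "linear S" and "order_continuous S"
    using system unfolding ce_preserving_system_def riesz_hom_def by auto
  show "0 \<le> S x" if "0 \<le> x" for x
    using S_sup[of 0 x] linear_0[OF lin] that by (simp add: sup_absorb2 le_iff_sup)
qed

section \<open>Strict positivity and invariance of the range of the conditional expectation\<close>

lemma T_eq_0D: "0 \<le> x \<Longrightarrow> T x \<le> 0 \<Longrightarrow> x = 0"
  using T_strict[of x] by (metis leD order_le_less)

text \<open>The usual form in which strict positivity enters: one inequality suffices for an
  equality as soon as both sides have the same expectation.\<close>

lemma le_T_fixed_eq: "x \<le> y \<Longrightarrow> T x = T y \<Longrightarrow> x = y"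
  using T_eq_0D[of "y - x"] by (simp add: T.diff)

text \<open>Makes the range of \<open>T\<close> a Riesz subspace. Positivity gives only
  \<open>sup k 0 \<le> T (sup k 0)\<close>; idempotence and strict positivity upgrade it.\<close>

lemma T_fixed_pos:
  assumes "T k = k"
  shows "T (sup k 0) = sup k 0"
proof -
  have "sup k 0 \<le> T (sup k 0)"
    using T.mono[of k "sup k 0"] T.pos[of "sup k 0"] assms by simp
  then show ?thesis by (rule le_T_fixed_eq[symmetric]) (simp add: T_T)
qed

text \<open>The first element is the \<open>S\<close>-image of the positive part of
  \<open>h - c e\<close>, the second its negative part. Both parts are fixed by \<open>T\<close>,
  and \<open>T\<close> does not see \<open>S\<close>, so the expectation of the infimum lies below
  two disjoint elements.\<close>

lemma S_T_fixed_disjoint: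
  assumes h: "T h = h"
  shows "inf (sup (S h - c *\<^sub>R e) 0) (sup (c *\<^sub>R e - h) 0) \<le> 0"
proof -
  let ?y = "sup (h - c *\<^sub>R e) 0" and ?n = "sup (- (h - c *\<^sub>R e)) 0"
  have n: "T ?n = ?n" and y: "T ?y = ?y"
    by (rule T_fixed_pos; simp add: T.diff T.scale T_e h T.neg del: minus_diff_eq)+
  have Sy: "S ?y = sup (S h - c *\<^sub>R e) 0" by (simp add: S_sup S.diff S.scale S_e S.zero)
  define t where "t = inf (S ?y) ?n"
  have t0: "0 \<le> t" unfolding t_def by (auto intro: S.pos)
  have "T t \<le> T (S ?y)" "T t \<le> T ?n" by (intro T.mono; simp add: t_def)+
  then have "T t \<le> inf ?y ?n" using n y T_S by simp
  also have "\<dots> = 0" by (rule pos_inf_neg)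
  finally have "t = 0" using t0 by (rule T_eq_0D[rotated])
  then show ?thesis by (simp add: t_def Sy)
qed

text \<open>
  The previous lemma excludes \<open>S h > c > h\<close> for every constant \<open>c\<close>; running through \<open>c = k \<delta>\<close> this
  excludes \<open>S h > h + 2 \<delta>\<close>.
\<close>

lemma S_T_fixed_le:
  assumes h: "T h = h" "0 \<le> h"
  shows "S h \<le> h"
proof (rule archimedean_eps)
  fix \<epsilon> :: real assume eps: "0 < \<epsilon>"
  define \<delta> where "\<delta> = \<epsilon> / 2"
  have \<delta>: "0 < \<delta>" "\<epsilon> = 2 * \<delta>" using eps by (auto simp: \<delta>_def)
  define d where "d = sup (S h - h - (2 * \<delta>) *\<^sub>R e) 0"
  define B where "B k = sup ((real k * \<delta>) *\<^sub>R e - h) 0" for k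
  have d0: "0 \<le> d" and B0: "0 \<le> B k" for k by (auto simp: d_def B_def)
  have dB: "inf (B k) d \<le> 0" for k
  proof (induction k)
    case 0
    have "B 0 = 0" using h by (simp add: B_def sup_absorb2)
    then show ?case by simp
  next
    case (Suc k)
    define w where "w = inf (B (Suc k)) d"
    have w: "0 \<le> w" "w \<le> B (Suc k)" "w \<le> d" using d0 B0 by (auto simp: w_def)
    let ?a = "sup (S h - (real (Suc k) * \<delta>) *\<^sub>R e) 0" and ?n = "sup (- (S h - h - (2 * \<delta>) *\<^sub>R e)) 0"
    \<comment> \<open>Each of the three summands has a positive part disjoint from \<open>w\<close>:
      by the previous lemma at level \<open>(k + 1) \<delta>\<close>, by definition of
      \<open>d\<close>, and by induction. The gap \<open>2 \<delta>\<close> in \<open>d\<close> pays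
      for one grid step and leaves \<open>\<delta> e\<close> on the left, so \<open>w\<close> is
      disjoint from the weak unit.\<close>
    have "\<delta> *\<^sub>R e = (S h - (real (Suc k) * \<delta>) *\<^sub>R e) + (- (S h - h - (2 * \<delta>) *\<^sub>R e))
        + ((real k * \<delta>) *\<^sub>R e - h)"
      by (simp add: algebra_simps flip: scaleR_add_left)
    also have "\<dots> \<le> ?a + ?n + B k" unfolding B_def by (intro add_mono) auto
    finally have "inf (\<delta> *\<^sub>R e) w \<le> inf (?a + ?n + B k) w" by (rule inf_mono) simp
    also have "\<dots> \<le> inf (?a + ?n) w + inf (B k) w" using w B0 by (intro inf_add_le) auto
    also have "\<dots> \<le> (inf ?a w + inf ?n w) + inf (B k) w"
      using w by (intro add_right_mono inf_add_le) auto
    also have "\<dots> \<le> (0 + 0) + 0"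
    proof (intro add_mono)
      have "inf ?a w \<le> inf ?a (B (Suc k))" using w by (intro inf_mono) auto
      then show "inf ?a w \<le> 0"
        using S_T_fixed_disjoint[OF h(1), of "real (Suc k) * \<delta>"] order_trans unfolding B_def by blast
      have "inf ?n w \<le> inf d ?n" using w by (auto intro: le_infI2)
      also have "\<dots> = 0" unfolding d_def by (rule pos_inf_neg)
      finally show "inf ?n w \<le> 0" .
      have "inf (B k) w \<le> inf (B k) d" using w by (intro inf_mono) auto
      then show "inf (B k) w \<le> 0" using Suc order_trans by blast
    qed
    finally have "inf (\<delta> *\<^sub>R e) w \<le> 0" by simp
    then have "inf ((1 / \<delta>) *\<^sub>R \<delta> *\<^sub>R e) w \<le> 0"
      by (rule inf_scaleR_nonpos) (use w \<delta> e_pos in \<open>auto simp: scaleR_nonneg_nonneg\<close>)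
    then have "inf w e \<le> 0" using \<delta> by (simp add: inf_commute)
    then have "w = 0" using w e_unit weak_unitD by blast
    then show ?case by (simp add: w_def)
  qed
  \<comment> \<open>\<open>B k\<close> lives where \<open>h < k \<delta> e\<close>, and
    \<open>d\<close> avoids all of these sets. On the part carrying \<open>d\<close> the element
    \<open>h\<close> thus dominates \<open>k \<delta> e\<close> for every \<open>k\<close>, which
    the Archimedean property rules out unless \<open>d'\<close> vanishes.\<close>
  define d' where "d' = inf d (\<delta> *\<^sub>R e)"
  have d'0: "0 \<le> d'" using d0 \<delta> e_pos by (auto simp: d'_def scaleR_nonneg_nonneg)
  have "real k *\<^sub>R d' \<le> h" for k
  proof -
    have k0: "0 \<le> real k *\<^sub>R d'" using d'0 by (simp add: scaleR_nonneg_nonneg)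
    have "real k *\<^sub>R d' \<le> real k *\<^sub>R (\<delta> *\<^sub>R e)" by (rule scaleR_left_mono) (auto simp: d'_def)
    also have "\<dots> = h + ((real k * \<delta>) *\<^sub>R e - h)" by simp
    also have "\<dots> \<le> h + B k" unfolding B_def by (intro add_left_mono) auto
    finally have "real k *\<^sub>R d' = inf (h + B k) (real k *\<^sub>R d')" by (simp add: inf_absorb2)
    also have "\<dots> \<le> inf h (real k *\<^sub>R d') + inf (B k) (real k *\<^sub>R d')"
      using k0 h B0 by (intro inf_add_le) auto
    also have "\<dots> \<le> h + 0"
    proof (intro add_mono)
      have "inf d' (B k) \<le> inf (B k) d" by (auto simp: d'_def intro: le_infI1)
      then have "inf d' (B k) \<le> 0" using dB order_trans by blast
      then have "inf (real k *\<^sub>R d') (B k) \<le> 0" by (rule inf_scaleR_nonpos) (use d'0 B0 in auto)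
      then show "inf (B k) (real k *\<^sub>R d') \<le> 0" by (simp add: inf_commute)
    qed simp
    finally show ?thesis by simp
  qed
  then have "d' \<le> 0" by (rule archimedean)
  then have "inf (\<delta> *\<^sub>R e) d \<le> 0" by (simp add: d'_def inf_commute)
  then have "inf ((1 / \<delta>) *\<^sub>R \<delta> *\<^sub>R e) d \<le> 0"
    by (rule inf_scaleR_nonpos) (use d0 \<delta> e_pos in \<open>auto simp: scaleR_nonneg_nonneg\<close>)
  then have "inf d e \<le> 0" using \<delta> by (simp add: inf_commute)
  then have "d = 0" using d0 e_unit weak_unitD by blast
  then have "S h - h - (2 * \<delta>) *\<^sub>R e \<le> 0" by (metis d_def sup.cobounded1)
  then show "S h \<le> h + \<epsilon> *\<^sub>R e" using \<delta> by (simp add: algebra_simps)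
qed (rule e_pos)

text \<open>\<open>S_T_fixed_le\<close> gives one inequality for positive arguments and
  \<open>T (S f) = T f\<close> turns it into equality; splitting into positive and negative parts
  does the rest.\<close>

lemma S_T: "S (T f) = T f"
proof -
  have *: "S (T g) = T g" if "0 \<le> g" for g
  proof (rule le_T_fixed_eq)
    show "S (T g) \<le> T g" using that by (intro S_T_fixed_le T_T T.pos)
  qed (simp add: T_S)
  have "T f = T (sup f 0) - T (sup (- f) 0)" by (simp only: pos_diff_neg flip: T.diff)
  then show ?thesis using *[of "sup f 0"] *[of "sup (- f) 0"] by (simp add: S.diff)
qed

section \<open>Birkhoff sums, their maxima and the maximal inequality\<close>

lemma birkhoff_sum_Suc: "birkhoff_sum S (Suc n) f = f + S (birkhoff_sum S n f)"
proof -
  have "birkhoff_sum S (Suc n) f = (S ^^ 0) f + (\<Sum>k<n. (S ^^ Suc k) f)"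
    unfolding birkhoff_sum_def by (rule sum.lessThan_Suc_shift)
  also have "(\<Sum>k<n. (S ^^ Suc k) f) = S (birkhoff_sum S n f)"
    unfolding birkhoff_sum_def linear_sum[OF S.lin] funpow.simps comp_def ..
  finally show ?thesis by simp
qed

lemma birkhoff_sum_0: "birkhoff_sum S 0 f = 0"
  by (simp add: birkhoff_sum_def)

lemma birkhoff_sum_diff: "birkhoff_sum S n (f - g) = birkhoff_sum S n f - birkhoff_sum S n g"
  by (induction n) (simp_all add: birkhoff_sum_0 birkhoff_sum_Suc S.diff)

lemma birkhoff_sum_fixed: "S g = g \<Longrightarrow> birkhoff_sum S n g = real n *\<^sub>R g"
  by (induction n) (simp_all add: birkhoff_sum_0 birkhoff_sum_Suc S.scale scaleR_add_left)

lemma hopf_max_pos: "0 \<le> hopf_max S n g"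
  by (cases n) auto

lemma hopf_max_Suc_ge: "hopf_max S n g \<le> hopf_max S (Suc n) g"
proof (induction n)
  case (Suc n)
  then show ?case
    by (auto simp only: hopf_max.simps intro!: sup_mono add_left_mono S.mono order_refl)
qed simp

lemma hopf_max_mono: "m \<le> n \<Longrightarrow> hopf_max S m g \<le> hopf_max S n g"
  by (rule lift_Suc_mono_le[of "\<lambda>n. hopf_max S n g", OF hopf_max_Suc_ge])

lemma hopf_max_mono2: "g \<le> g' \<Longrightarrow> hopf_max S n g \<le> hopf_max S n g'"
  by (induction n) (auto intro!: le_supI2 add_mono S.mono)

lemma birkhoff_sum_le_hopf_max: "birkhoff_sum S n g \<le> hopf_max S n g"
proof (induction n)
  case (Suc n)
  show ?case by (auto simp: birkhoff_sum_Suc intro!: le_supI2 S.mono Suc)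
qed (simp add: birkhoff_sum_def)

lemma birkhoff_avg_le_hopf_max:
  assumes "S c = c" "0 < n"
  shows "birkhoff_avg S n f - c \<le> (1 / real n) *\<^sub>R hopf_max S n (f - c)"
proof -
  have "birkhoff_avg S n f - c = (1 / real n) *\<^sub>R birkhoff_sum S n (f - c)"
    using assms by (simp add: birkhoff_avg_def birkhoff_sum_diff birkhoff_sum_fixed scaleR_diff_right)
  also have "\<dots> \<le> (1 / real n) *\<^sub>R hopf_max S n (f - c)"
    by (intro scaleR_left_mono birkhoff_sum_le_hopf_max) auto
  finally show ?thesis .
qed

text \<open>Garsia's argument with \<open>inf G e\<close> in place of the indicator of the set where
  \<open>G > 0\<close>. From \<open>G \<le> sup (y - l e) 0\<close> with \<open>y = b + S G\<close>
  follows \<open>l (inf G e) + G \<le> b + S G\<close>; under \<open>T\<close> the terms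
  \<open>G\<close> and \<open>S G\<close> cancel.\<close>

lemma hopf_maximal:
  assumes b: "0 \<le> b" and l: "0 < l"
  shows "l *\<^sub>R T (inf (hopf_max S n (b - l *\<^sub>R e)) e) \<le> T b"
proof -
  define G where "G = hopf_max S n (b - l *\<^sub>R e)"
  define y where "y = b + S G"
  have y0: "0 \<le> y" unfolding y_def G_def using b S.pos[OF hopf_max_pos] by simp
  have "G \<le> sup 0 (b - l *\<^sub>R e + S G)"
    using hopf_max_Suc_ge[of n "b - l *\<^sub>R e"] by (simp add: G_def)
  then have G: "G \<le> sup (y - l *\<^sub>R e) 0" by (simp add: y_def sup_commute algebra_simps)
  have "l *\<^sub>R inf G e \<le> l *\<^sub>R inf (1 *\<^sub>R sup (y - l *\<^sub>R e) 0) e"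
    using G l by (intro scaleR_left_mono inf_mono) auto
  also have "\<dots> \<le> y" by (rule scale_inf_pos_le) (use y0 l in auto)
  finally have "l *\<^sub>R inf G e \<le> y" .
  moreover have "l *\<^sub>R inf G e \<le> l *\<^sub>R e" using l by (intro scaleR_left_mono) auto
  ultimately have "l *\<^sub>R inf G e \<le> inf y (l *\<^sub>R e)" by simp
  with G have "l *\<^sub>R inf G e + G \<le> inf y (l *\<^sub>R e) + sup (y - l *\<^sub>R e) 0" by (rule add_mono[rotated])
  also have "sup (y - l *\<^sub>R e) 0 = y - inf y (l *\<^sub>R e)"
    using add_sup_distrib_left[of y "- y" "- (l *\<^sub>R e)"] by (simp add: diff_inf_eq_sup sup_commute)
  finally have "l *\<^sub>R inf G e + G \<le> y" by (simp only: add_diff_eq add_diff_cancel_left')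
  then have "T (l *\<^sub>R inf G e + G) \<le> T y" by (rule T.mono)
  then show ?thesis by (simp add: y_def T.add T.scale T_S G_def)
qed

text \<open>Expresses that \<open>T\<close> commutes with multiplication by a \<open>T\<close>-fixed
  indicator \<open>p\<close>. The truncation of \<open>x\<close> at \<open>n e\<close> lies below
  \<open>n (e - p)\<close>, which \<open>T\<close> fixes and which is disjoint from
  \<open>p\<close>; the truncations increase to \<open>x\<close>.\<close>

lemma T_disjoint_component:
  assumes p: "T p = p" "0 \<le> p" "p \<le> e" "inf p (e - p) \<le> 0"
    and x: "0 \<le> x" "inf x p \<le> 0"
  shows "inf (T x) p \<le> 0"
proof -
  have up: "up_directed (range (\<lambda>n::nat. inf x (real n *\<^sub>R e)))"
    by (intro up_directed_range inf_mono order_refl scaleR_right_mono e_pos of_nat_mono)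
  have lub: "is_lub (T ` range (\<lambda>n::nat. inf x (real n *\<^sub>R e))) (T x)"
    by (rule T.lub[OF up weak_unit_is_lub[OF e_unit x(1)]])
  have "inf (T (inf x (real n *\<^sub>R e))) p \<le> 0" for n
  proof -
    have ep: "0 \<le> e - p" using p by simp
    have "inf x (real n *\<^sub>R e) = inf (real n *\<^sub>R p + real n *\<^sub>R (e - p)) x"
      by (simp add: inf_commute flip: scaleR_add_right)
    also have "\<dots> \<le> inf (real n *\<^sub>R p) x + inf (real n *\<^sub>R (e - p)) x"
      using p x ep by (intro inf_add_le) (auto simp: scaleR_nonneg_nonneg)
    also have "\<dots> \<le> 0 + real n *\<^sub>R (e - p)"
      using p x by (intro add_mono inf_scaleR_nonpos) (auto simp: inf_commute)
    finally have "T (inf x (real n *\<^sub>R e)) \<le> T (real n *\<^sub>R (e - p))" by (intro T.mono) simp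
    also have "\<dots> = real n *\<^sub>R (e - p)" by (simp add: T.scale T.diff T_e p)
    finally have "inf (T (inf x (real n *\<^sub>R e))) p \<le> inf (real n *\<^sub>R (e - p)) p"
      by (rule inf_mono) simp
    also have "\<dots> \<le> 0" by (rule inf_scaleR_nonpos) (use p ep in \<open>auto simp: inf_commute\<close>)
    finally show ?thesis .
  qed
  then show ?thesis by (intro is_lub_least[OF is_lub_inf[OF lub]]) auto
qed

text \<open>
  The indicator \<open>p\<close> of the set where the maxima \<open>G n\<close> of the Birkhoff sums of \<open>g\<close> are unbounded is
  invariant, hence fixed by \<open>T\<close>. On that set \<open>G (n + 1) - S (G n)\<close> decreases to \<open>g\<close>, while
  \<open>T (G (n + 1) - S (G n)) \<ge> 0\<close>; as \<open>T g < 0\<close>, the set is null.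
\<close>

lemma hopf_max_negative_null:
  fixes g :: 'a and \<epsilon> :: real
  assumes erg: "ergodic T S" and eps: "0 < \<epsilon>" and Tg: "T g = - (\<epsilon> *\<^sub>R e)"
  defines "G \<equiv> \<lambda>n. hopf_max S n g"
  defines "r \<equiv> \<lambda>m. Sup (range (\<lambda>n. inf ((1 / real (Suc m)) *\<^sub>R G n) e))"
  assumes l: "\<And>m. l \<le> r m"
  shows "l \<le> 0"
proof -
  have G0: "0 \<le> G n" for n by (simp add: G_def hopf_max_pos)
  have Gmono: "m \<le> n \<Longrightarrow> G m \<le> G n" for m n unfolding G_def by (rule hopf_max_mono)
  have G_Suc: "G (Suc n) = sup 0 (g + S (G n))" for n by (simp add: G_def)
  let ?f = "\<lambda>m n. inf ((1 / real (Suc m)) *\<^sub>R G n) e"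
  have f0: "0 \<le> ?f m n" for m n using G0 e_pos by (auto simp: scaleR_nonneg_nonneg)
  have r_lub: "is_lub (range (?f m)) (r m)" for m
    unfolding r_def by (rule is_lub_Sup) (auto intro!: bdd_aboveI[of _ e])
  have r_le: "r m \<le> e" for m by (rule is_lub_least[OF r_lub]) auto
  have f_le_r: "?f m n \<le> r m" for m n by (rule is_lub_upper[OF r_lub]) auto
  have r0: "0 \<le> r m" for m by (rule order_trans[OF f0 f_le_r])
  have r_dec: "r m' \<le> r m" if "m \<le> m'" for m m'
  proof (rule is_lub_least[OF r_lub])
    fix a assume "a \<in> range (?f m')"
    then obtain n where "a = ?f m' n" by auto
    also have "\<dots> \<le> ?f m n"
      using that G0 by (intro inf_mono scaleR_right_mono) (auto simp: frac_le)
    finally show "a \<le> r m" using f_le_r order_trans by blast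
  qed
  define p where "p = Inf (range r)"
  have bdd: "bdd_below (range r)" using r0 by (auto intro: bdd_belowI[of _ 0])
  have p_le: "p \<le> r m" for m unfolding p_def by (rule cInf_lower) (use bdd in auto)
  have p_greatest: "a \<le> p" if "\<And>m. a \<le> r m" for a
    unfolding p_def by (rule cInf_greatest) (use that in auto)
  have p0: "0 \<le> p" by (rule p_greatest) (rule r0)
  have pe: "p \<le> e" using p_le r_le order_trans by blast
  have p_comp: "inf p (e - p) \<le> 0"
  proof (rule le_component_imp_disjoint, rule p_greatest)
    fix m
    \<comment> \<open>The index \<open>2 m + 1\<close> is chosen because
      \<open>Suc (2 m + 1) = 2 (Suc m)\<close>, so doubling turns its factor into that of
      \<open>r m\<close>.\<close>
    have "is_lub ((\<lambda>x. inf x e) ` ((\<lambda>x. 2 *\<^sub>R x) ` range (?f (2 * m + 1)))) (inf (2 *\<^sub>R r (2 * m + 1)) e)"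
      by (intro is_lub_inf is_lub_scaleR r_lub) auto
    then have "inf (2 *\<^sub>R r (2 * m + 1)) e \<le> r m"
    proof (rule is_lub_least)
      fix a assume "a \<in> (\<lambda>x. inf x e) ` ((\<lambda>x. 2 *\<^sub>R x) ` range (?f (2 * m + 1)))"
      then obtain n where a: "a = inf (2 *\<^sub>R ?f (2 * m + 1) n) e" by auto
      have "2 *\<^sub>R ?f (2 * m + 1) n \<le> 2 *\<^sub>R (1 / real (Suc (2 * m + 1))) *\<^sub>R G n"
        by (rule scaleR_left_mono) auto
      also have "\<dots> = (1 / real (Suc m)) *\<^sub>R G n" by (simp add: field_simps)
      finally have "a \<le> ?f m n" unfolding a by (rule inf_mono) simp
      then show "a \<le> r m" using f_le_r order_trans by blast
    qed
    moreover have "inf (2 *\<^sub>R p) e \<le> inf (2 *\<^sub>R r (2 * m + 1)) e"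
      using p_le by (intro inf_mono scaleR_left_mono) auto
    ultimately show "inf (2 *\<^sub>R p) e \<le> r m" by (rule order_trans[rotated])
  qed
  define h where "h = sup (- g) 0"
  have h0: "0 \<le> h" by (simp add: h_def)
  have Sr_lub: "is_lub (S ` range (?f m)) (S (r m))" for m
    by (rule S.lub[OF up_directed_range r_lub], intro inf_mono order_refl scaleR_left_mono Gmono) auto
  have Sf: "S (?f m n) = inf ((1 / real (Suc m)) *\<^sub>R S (G n)) e" for m n
    by (simp add: S_inf S.scale S_e)
  \<comment> \<open>From \<open>S (G n) \<le> G (Suc n) + h\<close>: shifting costs only the fixed
    element \<open>h\<close>, which the division by \<open>Suc m\<close> makes negligible in the
    limit.\<close>
  have Sr: "S (r m) \<le> r m + (1 / real (Suc m)) *\<^sub>R h" for m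
  proof (rule is_lub_least[OF Sr_lub])
    fix a assume "a \<in> S ` range (?f m)"
    then obtain n where a: "a = inf ((1 / real (Suc m)) *\<^sub>R S (G n)) e" using Sf by auto
    have "S (G n) = (g + S (G n)) + (- g)" by simp
    also have "\<dots> \<le> G (Suc n) + h" unfolding G_Suc h_def by (intro add_mono) auto
    finally have "(1 / real (Suc m)) *\<^sub>R S (G n) \<le> (1 / real (Suc m)) *\<^sub>R (G (Suc n) + h)"
      by (rule scaleR_left_mono) auto
    then have "a \<le> inf ((1 / real (Suc m)) *\<^sub>R G (Suc n) + (1 / real (Suc m)) *\<^sub>R h) e"
      unfolding a by (intro inf_mono) (simp_all add: scaleR_add_right)
    also have "\<dots> \<le> ?f m (Suc n) + inf ((1 / real (Suc m)) *\<^sub>R h) e"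
      using G0 h0 e_pos by (intro inf_add_le) (auto simp: scaleR_nonneg_nonneg)
    also have "\<dots> \<le> r m + (1 / real (Suc m)) *\<^sub>R h" by (intro add_mono f_le_r) auto
    finally show "a \<le> \<dots>" .
  qed
  have "S p \<le> p"
  proof (rule p_greatest)
    fix m0
    show "S p \<le> r m0"
    proof (rule archimedean_div[of "Suc m0"])
      fix m assume m: "Suc m0 \<le> m" "0 < m"
      then obtain m' where m': "m = Suc m'" "m0 \<le> m'" by (cases m) auto
      have "S p \<le> S (r m')" using p_le by (rule S.mono)
      also note Sr[of m']
      also have "r m' + (1 / real (Suc m')) *\<^sub>R h \<le> r m0 + (1 / real m) *\<^sub>R h"
        using r_dec m' by (intro add_mono) auto
      finally show "S p \<le> r m0 + (1 / real m) *\<^sub>R h" .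
    qed (rule h0)
  qed
  \<comment> \<open>This is where ergodicity is applied: it turns the invariance of \<open>p\<close>
    into \<open>T p = p\<close>.\<close>
  then have Sp: "S p = p" by (rule le_T_fixed_eq) (rule T_S)
  then have Tp: "T p = p" using erg unfolding ergodic_def by blast
  \<comment> \<open>With \<open>h\<close> the negative part of \<open>g\<close>, the increment
    \<open>G (Suc n) - S (G n)\<close> is at most \<open>sup g 0 - ?k n\<close>, and its expectation
    is nonnegative because \<open>G\<close> increases. In the limit
    \<open>T k \<le> T (sup g 0)\<close>, so \<open>T g = - \<epsilon> e\<close> leaves
    \<open>T (h - k) \<ge> \<epsilon> e\<close>.\<close>
  let ?k = "\<lambda>n. inf (S (G n)) h"
  define k where "k = Sup (range ?k)"
  have k_lub: "is_lub (range ?k) k"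
    unfolding k_def by (rule is_lub_Sup) (auto intro!: bdd_aboveI[of _ h])
  have Tk_lub: "is_lub (T ` range ?k) (T k)"
    by (rule T.lub[OF up_directed_range k_lub]) (intro inf_mono S.mono Gmono order_refl)
  have "T k \<le> T (sup g 0)"
  proof (rule is_lub_least[OF Tk_lub])
    fix a assume "a \<in> T ` range ?k"
    then obtain n where a: "a = T (?k n)" by auto
    have "g + S (G n) + ?k n \<le> g + S (G n) + h" by simp
    also have "\<dots> = sup g 0 + S (G n)"
      using pos_diff_neg[of g] unfolding h_def[symmetric] by (simp add: algebra_simps)
    finally have "g + S (G n) \<le> sup g 0 + S (G n) - ?k n" unfolding le_diff_eq .
    moreover have "?k n \<le> sup g 0 + S (G n)" by (intro le_infI1) simp
    then have "0 \<le> sup g 0 + S (G n) - ?k n" by (simp only: le_diff_eq add_0)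
    ultimately have "G (Suc n) \<le> sup g 0 + S (G n) - ?k n" unfolding G_Suc by (rule le_supI[rotated])
    then have "T (G (Suc n)) \<le> T (sup g 0 + S (G n) - ?k n)" by (rule T.mono)
    also have "\<dots> = T (sup g 0) + T (G n) - a" by (simp only: T.add T.diff T_S a)
    finally have "T (G n) \<le> T (sup g 0) + T (G n) - a"
      using T.mono[OF Gmono[of n "Suc n"]] order_trans by force
    then have "T (G n) + a \<le> T (G n) + T (sup g 0)" by (simp only: le_diff_eq add.commute)
    then show "a \<le> T (sup g 0)" by simp
  qed
  then have "T h - T (sup g 0) \<le> T h - T k" by (rule diff_left_mono)
  moreover have "T h - T (sup g 0) = \<epsilon> *\<^sub>R e"
    using Tg pos_diff_neg[of g] unfolding h_def[symmetric] T.diff[symmetric]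
    by (metis T.neg minus_diff_eq minus_minus)
  ultimately have Thk: "\<epsilon> *\<^sub>R e \<le> T (h - k)" by (simp add: T.diff)
  have "k \<le> h" by (rule is_lub_least[OF k_lub]) auto
  then have hk0: "0 \<le> h - k" by simp
  have kn: "?k n \<le> k" for n by (rule is_lub_upper[OF k_lub]) auto
  \<comment> \<open>Where the maxima are unbounded, \<open>S (G n)\<close> eventually exceeds
    \<open>h\<close>, so \<open>k\<close> equals \<open>h\<close> there. Quantitatively, an element
    below both \<open>S (G n) / m\<close> and \<open>sup (h - S (G n)) 0\<close> is at most
    \<open>h / m\<close>. Then \<open>T (h - k)\<close>, which is at least
    \<open>\<epsilon> e\<close>, is also disjoint from \<open>p\<close>.\<close>
  have "inf (h - k) p \<le> 0"
  proof (rule archimedean_div[of 1])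
    fix m :: nat assume m: "1 \<le> m"
    then obtain m' where m': "m = Suc m'" by (cases m) auto
    have "inf p (h - k) \<le> inf (S (r m')) (h - k)"
      using S.mono[OF p_le[of m']] Sp by (intro inf_mono) auto
    also have "\<dots> \<le> (1 / real m) *\<^sub>R h"
    proof (rule is_lub_least[OF is_lub_inf[OF Sr_lub]])
      fix a assume "a \<in> (\<lambda>x. inf x (h - k)) ` S ` range (?f m')"
      then obtain n where a: "a = inf (inf ((1 / real m) *\<^sub>R S (G n)) e) (h - k)" using Sf m' by auto
      have "h - k \<le> h - ?k n" by (rule diff_left_mono[OF kn])
      also have "\<dots> = sup (h - S (G n)) 0"
        using add_sup_distrib_left[of h "- S (G n)" "- h"] by (simp add: diff_inf_eq_sup)
      finally have a1: "a \<le> sup (h - S (G n)) 0" unfolding a by (rule le_infI2)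
      have "a \<le> (1 / real m) *\<^sub>R S (G n)" by (auto simp: a intro: le_infI1)
      from scaleR_left_mono[OF this, of "real m"] m have a2: "real m *\<^sub>R a \<le> S (G n)" by simp
      define u where "u = sup (real m *\<^sub>R a - h) 0"
      have "real m *\<^sub>R a - h \<le> - (h - S (G n))" using a2 by simp
      then have u1: "u \<le> sup (- (h - S (G n))) 0" unfolding u_def by (rule sup_mono) simp
      have "real m *\<^sub>R a - h \<le> real m *\<^sub>R a" using h0 by simp
      also have "\<dots> \<le> real m *\<^sub>R sup (h - S (G n)) 0" using a1 by (rule scaleR_left_mono) simp
      finally have u2: "u \<le> real m *\<^sub>R sup (h - S (G n)) 0"
        unfolding u_def by (intro le_supI) (auto simp: scaleR_nonneg_nonneg)
      have "u \<le> 0" by (rule le_pos_le_neg_imp_nonpos[OF u2 u1]) simp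
      then have "real m *\<^sub>R a \<le> h" by (simp add: u_def)
      from scaleR_left_mono[OF this, of "1 / real m"] m show "a \<le> (1 / real m) *\<^sub>R h" by simp
    qed
    finally show "inf (h - k) p \<le> 0 + (1 / real m) *\<^sub>R h" by (simp add: inf_commute)
  qed (rule h0)
  then have "inf (T (h - k)) p \<le> 0"
    by (intro T_disjoint_component Tp p0 pe p_comp hk0)
  then have "inf (\<epsilon> *\<^sub>R e) p \<le> 0" using Thk by (meson inf_mono order_refl order_trans)
  then have "inf ((1 / \<epsilon>) *\<^sub>R (\<epsilon> *\<^sub>R e)) p \<le> 0"
    by (rule inf_scaleR_nonpos) (use eps e_pos p0 in \<open>auto simp: scaleR_nonneg_nonneg\<close>)
  then have "p \<le> 0" using eps pe by (simp add: inf_absorb2)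
  moreover have "l \<le> p" by (rule p_greatest) (rule l)
  ultimately show ?thesis by simp
qed

text \<open>Subtracting the invariant \<open>c = T f + \<epsilon> e\<close> leaves an element of
  expectation \<open>- \<epsilon> e\<close>, whose Birkhoff maxima divided by \<open>Suc m\<close>
  and truncated at \<open>e\<close> have the null bounds \<open>r m\<close>. Lengths are
  \<open>Suc n\<close> to avoid the average of length 0.\<close>

lemma birkhoff_avg_pos_part:
  assumes erg: "ergodic T S" and eps: "0 < \<epsilon>"
  obtains r :: "nat \<Rightarrow> 'a"
  where "\<And>m n. m \<le> n \<Longrightarrow> r n \<le> r m" "\<And>l. (\<And>n. l \<le> r n) \<Longrightarrow> l \<le> 0"
    "\<And>n. inf (sup (birkhoff_avg S (Suc n) f - T f) 0) e \<le> \<epsilon> *\<^sub>R e + r n"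
proof
  define c where "c = T f + \<epsilon> *\<^sub>R e"
  define g where "g = f - c"
  define r where "r m = Sup (range (\<lambda>n. inf ((1 / real (Suc m)) *\<^sub>R hopf_max S n g) e))" for m
  have r_lub: "is_lub (range (\<lambda>n. inf ((1 / real (Suc m)) *\<^sub>R hopf_max S n g) e)) (r m)" for m
    unfolding r_def by (rule is_lub_Sup) (auto intro!: bdd_aboveI[of _ e])
  have Sc: "S c = c" by (simp add: c_def S.add S.scale S_T S_e)
  have Tg: "T g = - (\<epsilon> *\<^sub>R e)" by (simp add: g_def c_def T.diff T.add T_T T.scale T_e)
  show "r n \<le> r m" if "m \<le> n" for m n
  proof (rule is_lub_least[OF r_lub])
    fix a assume "a \<in> range (\<lambda>k. inf ((1 / real (Suc n)) *\<^sub>R hopf_max S k g) e)"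
    then obtain k where "a = inf ((1 / real (Suc n)) *\<^sub>R hopf_max S k g) e" by auto
    also have "\<dots> \<le> inf ((1 / real (Suc m)) *\<^sub>R hopf_max S k g) e"
      using that hopf_max_pos by (intro inf_mono scaleR_right_mono) (auto simp: frac_le)
    also have "\<dots> \<le> r m" by (rule is_lub_upper[OF r_lub]) auto
    finally show "a \<le> r m" .
  qed
  show "l \<le> 0" if "\<And>n. l \<le> r n" for l
    using hopf_max_negative_null[OF erg eps Tg] that unfolding r_def by blast
  fix n
  let ?G = "(1 / real (Suc n)) *\<^sub>R hopf_max S (Suc n) g"
  have G0: "0 \<le> ?G" using hopf_max_pos by (simp add: scaleR_nonneg_nonneg del: hopf_max.simps)
  have e0: "0 \<le> \<epsilon> *\<^sub>R e" using eps e_pos by (simp add: scaleR_nonneg_nonneg)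
  have "birkhoff_avg S (Suc n) f - c \<le> ?G"
    unfolding g_def by (rule birkhoff_avg_le_hopf_max[OF Sc]) simp
  then have "birkhoff_avg S (Suc n) f - T f \<le> \<epsilon> *\<^sub>R e + ?G"
    by (simp add: c_def algebra_simps del: hopf_max.simps)
  then have "sup (birkhoff_avg S (Suc n) f - T f) 0 \<le> \<epsilon> *\<^sub>R e + ?G"
    using G0 e0 by (intro le_supI add_nonneg_nonneg)
  then have "inf (sup (birkhoff_avg S (Suc n) f - T f) 0) e \<le> inf (\<epsilon> *\<^sub>R e + ?G) e"
    by (rule inf_mono) simp
  also have "\<dots> \<le> inf (\<epsilon> *\<^sub>R e) e + inf ?G e"
    by (rule inf_add_le) (use e_pos e0 G0 in auto)
  also have "\<dots> \<le> \<epsilon> *\<^sub>R e + r n"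
    by (intro add_mono is_lub_upper[OF r_lub] rangeI) simp
  finally show "inf (sup (birkhoff_avg S (Suc n) f - T f) 0) e \<le> \<epsilon> *\<^sub>R e + r n" .
qed

lemma birkhoff_avg_neg: "birkhoff_avg S n (- f) = - birkhoff_avg S n f"
  using birkhoff_sum_diff[of n 0 f] birkhoff_sum_fixed[of 0 n]
  by (simp add: birkhoff_avg_def S.zero)

lemma birkhoff_avg_uo:
  assumes erg: "ergodic T S" and eps: "0 < \<epsilon>"
  obtains r :: "nat \<Rightarrow> 'a"
  where "\<And>m n. m \<le> n \<Longrightarrow> r n \<le> r m" "\<And>l. (\<And>n. l \<le> r n) \<Longrightarrow> l \<le> 0"
    "\<And>n. inf \<bar>birkhoff_avg S (Suc n) f - T f\<bar> e \<le> \<epsilon> *\<^sub>R e + r n"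
proof -
  obtain r where r: "\<And>m n. m \<le> n \<Longrightarrow> r n \<le> r m" "\<And>l. (\<And>n. l \<le> r n) \<Longrightarrow> l \<le> 0"
    "\<And>n. inf (sup (birkhoff_avg S (Suc n) f - T f) 0) e \<le> (\<epsilon> / 2) *\<^sub>R e + r n"
    using birkhoff_avg_pos_part[OF erg, of "\<epsilon> / 2" f] eps by auto
  obtain q where q: "\<And>m n. m \<le> n \<Longrightarrow> q n \<le> q m" "\<And>l. (\<And>n. l \<le> q n) \<Longrightarrow> l \<le> 0"
    "\<And>n. inf (sup (birkhoff_avg S (Suc n) (- f) - T (- f)) 0) e \<le> (\<epsilon> / 2) *\<^sub>R e + q n"
    using birkhoff_avg_pos_part[OF erg, of "\<epsilon> / 2" "- f"] eps by auto
  show thesis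
  proof (rule that[of "\<lambda>n. r n + q n"])
    show "r n + q n \<le> r m + q m" if "m \<le> n" for m n using that r q by (intro add_mono) auto
    show "l \<le> 0" if l: "\<And>n. l \<le> r n + q n" for l
    proof (rule q(2))
      fix m
      have "l - q m \<le> r n" for n
      proof -
        have "l \<le> r (max m n) + q (max m n)" by (rule l)
        also have "\<dots> \<le> r n + q m" using r q by (intro add_mono) auto
        finally show ?thesis by (simp add: diff_le_eq)
      qed
      then have "l - q m \<le> 0" by (rule r(2))
      then show "l \<le> q m" by simp
    qed
    fix n
    define x where "x = birkhoff_avg S (Suc n) f - T f"
    have x: "sup (birkhoff_avg S (Suc n) (- f) - T (- f)) 0 = sup (- x) 0"
      by (simp add: birkhoff_avg_neg T.neg x_def)
    have "\<bar>x\<bar> \<le> sup x 0 + sup (- x) 0"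
      unfolding abs_lattice by (auto intro: add_increasing add_increasing2)
    then have "inf \<bar>x\<bar> e \<le> inf (sup x 0 + sup (- x) 0) e" by (rule inf_mono) simp
    also have "\<dots> \<le> inf (sup x 0) e + inf (sup (- x) 0) e" using e_pos by (intro inf_add_le) auto
    also have "\<dots> \<le> ((\<epsilon> / 2) *\<^sub>R e + r n) + ((\<epsilon> / 2) *\<^sub>R e + q n)"
      using r(3)[of n] q(3)[of n] unfolding x x_def[symmetric] by (rule add_mono)
    also have "\<dots> = \<epsilon> *\<^sub>R e + (r n + q n)"
      by (simp add: algebra_simps flip: scaleR_add_left)
    finally show "inf \<bar>birkhoff_avg S (Suc n) f - T f\<bar> e \<le> \<epsilon> *\<^sub>R e + (r n + q n)"
      unfolding x_def .
  qed
qed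

end

section \<open>The natural domain\<close>

locale riesz_completion =
  fixes j :: "'a::dedekind_complete_riesz_space \<Rightarrow> 'u::universally_complete_riesz_space"
  assumes completion: "universal_completion j"
begin

section \<open>The embedding into the universal completion\<close>

lemma j_lin: "linear j" and j_sup: "j (sup x y) = sup (j x) (j y)"
  and j_inf: "j (inf x y) = inf (j x) (j y)" and j_inj: "j x = j y \<longleftrightarrow> x = y"
  and j_dense: "0 < z \<Longrightarrow> \<exists>x>0. j x \<le> z"
  using completion unfolding universal_completion_def riesz_hom_def by (simp_all add: inj_eq)

lemma j_add: "j (x + y) = j x + j y" using j_lin by (rule linear_add)
lemma j_diff: "j (x - y) = j x - j y" using j_lin by (rule linear_diff)
lemma j_neg: "j (- x) = - j x" using j_lin by (rule linear_neg)
lemma j_scale: "j (c *\<^sub>R x) = c *\<^sub>R j x" using j_lin by (rule linear_scale)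
lemma j_0: "j 0 = 0" using j_lin by (rule linear_0)

lemma j_le_iff: "j x \<le> j y \<longleftrightarrow> x \<le> y"
  by (simp only: le_iff_inf j_inj flip: j_inf)

lemma j_pos_iff: "0 \<le> j x \<longleftrightarrow> 0 \<le> x"
  using j_le_iff[of 0 x] by (simp add: j_0)

lemma j_abs: "j \<bar>x\<bar> = \<bar>j x\<bar>"
  by (simp add: abs_lattice j_sup j_neg)

text \<open>Order density does this: a gap between \<open>j s\<close> and a smaller upper bound
  would contain some \<open>j x\<close> with \<open>x > 0\<close>, and then \<open>s - x\<close>
  would bound \<open>A\<close> already in E.\<close>

lemma j_lub:
  assumes "is_lub A s"
  shows "is_lub (j ` A) (j s)"
proof (rule is_lubI)
  fix u assume u: "\<And>a. a \<in> j ` A \<Longrightarrow> a \<le> u"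
  define v where "v = inf u (j s)"
  have v: "j a \<le> v" if "a \<in> A" for a
    using u that is_lub_upper[OF assms that] by (auto simp: v_def j_le_iff)
  show "j s \<le> u"
  proof (rule ccontr)
    assume "\<not> j s \<le> u"
    then have "0 < j s - v" unfolding v_def by (metis diff_gt_0_iff_gt inf.cobounded2 inf.orderI inf_commute order_le_less)
    then obtain x where x: "0 < x" "j x \<le> j s - v" using j_dense by blast
    have "s \<le> s - x"
    proof (rule is_lub_least[OF assms])
      fix a assume "a \<in> A"
      then have "j a + j x \<le> v + (j s - v)" using v x by (intro add_mono) auto
      then have "j (a + x) \<le> j s" by (simp add: j_add)
      then show "a \<le> s - x" by (simp add: j_le_iff le_diff_eq)
    qed
    then show False using x by simp
  qed
qed (use is_lub_upper[OF assms] in \<open>auto simp: j_le_iff\<close>)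

lemma j_lub_iff: "is_lub (j ` A) (j s) \<longleftrightarrow> is_lub A s"
proof
  assume *: "is_lub (j ` A) (j s)"
  show "is_lub A s"
  proof (rule is_lubI)
    show "a \<le> s" if "a \<in> A" for a
      using is_lub_upper[OF *, of "j a"] that by (simp add: j_le_iff)
    show "s \<le> u" if "\<And>a. a \<in> A \<Longrightarrow> a \<le> u" for u
      unfolding j_le_iff[symmetric, of s] by (rule is_lub_least[OF *]) (use that in \<open>auto simp: j_le_iff\<close>)
  qed
qed (rule j_lub)

lemma weak_unit_j:
  assumes "weak_unit e"
  shows "weak_unit (j e)"
  unfolding weak_unit_def
proof (intro conjI allI impI)
  show "0 \<le> j e" using weak_unit_pos[OF assms] by (simp add: j_pos_iff)
  fix y assume y: "inf \<bar>y\<bar> (j e) = 0"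
  show "y = 0"
  proof (rule ccontr)
    assume "y \<noteq> 0"
    then have "0 < \<bar>y\<bar>" by simp
    then obtain x where x: "0 < x" "j x \<le> \<bar>y\<bar>" using j_dense by blast
    then have "j (inf x e) \<le> inf \<bar>y\<bar> (j e)" by (auto simp: j_inf intro: le_infI1)
    then have "j (inf x e) \<le> j 0" using y by (simp only: j_0)
    then have "inf x e \<le> 0" by (simp only: j_le_iff)
    then have "x = 0" using weak_unitD[OF assms] x by (meson order_less_imp_le)
    then show False using x by simp
  qed
qed

text \<open>If some \<open>j x\<close> with \<open>x > 0\<close> fits between \<open>y\<close> and a
  smaller bound, then \<open>x\<close> can be added again and again without leaving the set, so all
  multiples of \<open>j x\<close> stay below \<open>y\<close>.\<close>

lemma j_dense_lub:
  assumes "0 \<le> y"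
  shows "is_lub (j ` {a. 0 \<le> a \<and> j a \<le> y}) y"
proof (rule is_lubI)
  fix u assume u: "\<And>a. a \<in> j ` {a. 0 \<le> a \<and> j a \<le> y} \<Longrightarrow> a \<le> u"
  define v where "v = inf u y"
  have v: "j a \<le> v" if "0 \<le> a" "j a \<le> y" for a using u that by (auto simp: v_def)
  show "y \<le> u"
  proof (rule ccontr)
    assume "\<not> y \<le> u"
    then have "0 < y - v" unfolding v_def by (metis diff_gt_0_iff_gt inf.cobounded2 inf.orderI inf_commute order_le_less)
    then obtain x where x: "0 < x" "j x \<le> y - v" using j_dense by blast
    have "real n *\<^sub>R j x \<le> y" for n
    proof (induction n)
      case (Suc n)
      have "j (real n *\<^sub>R x) \<le> v" using Suc x by (intro v) (auto simp: j_scale scaleR_nonneg_nonneg)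
      then have "j (real n *\<^sub>R x) + j x \<le> v + (y - v)" using x by (intro add_mono) auto
      then show ?case by (simp add: j_scale algebra_simps)
    qed (use assms in simp)
    then have "j x \<le> 0" by (rule archimedean)
    then have "x \<le> 0" using j_le_iff[of x 0] by (simp add: j_0)
    then show False using x by simp
  qed
qed auto

text \<open>Dedekind completeness of E makes its image an ideal. This brings elements below
  \<open>j e\<close> back into E, where \<open>T\<close> and its strict positivity are
  available.\<close>

lemma j_ideal:
  assumes "0 \<le> y" "y \<le> j x"
  obtains z where "0 \<le> z" "j z = y"
proof -
  let ?A = "{a. 0 \<le> a \<and> j a \<le> y}"
  have "is_lub ?A (Sup ?A)"
  proof (rule is_lub_Sup)
    show "?A \<noteq> {}" using assms by (auto simp: j_0 intro!: exI[of _ 0])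
    show "bdd_above ?A" using assms by (intro bdd_aboveI[of _ x]) (auto simp flip: j_le_iff)
  qed
  then have "j (Sup ?A) = y" using j_lub j_dense_lub[OF assms(1)] is_lub_unique by blast
  then show thesis using that assms(1) by (metis j_pos_iff)
qed

text \<open>Independence of the approximating net: for fixed \<open>a\<close> the elements
  \<open>inf b a\<close> increase to \<open>a\<close> inside E, so order continuity of
  \<open>R\<close> applies there.\<close>

lemma sup_ext_mono_aux:
  assumes R: "positive_order_continuous R"
    and A: "increases_to j A x" and B: "increases_to j B x"
    and u: "\<And>b. b \<in> B \<Longrightarrow> j (R b) \<le> u" and a: "a \<in> A"
  shows "j (R a) \<le> u"
proof -
  interpret R: positive_order_continuous R by fact
  have "j a \<le> x" using A a is_lub_upper unfolding increases_to_def by blast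
  moreover have "is_lub ((\<lambda>y. inf y (j a)) ` j ` B) (inf x (j a))"
    using B by (intro is_lub_inf) (simp add: increases_to_def)
  ultimately have "is_lub (j ` (\<lambda>b. inf b a) ` B) (j a)"
    by (simp add: inf_absorb2 image_image j_inf)
  then have lub: "is_lub ((\<lambda>b. inf b a) ` B) a" by (simp only: j_lub_iff)
  have "up_directed ((\<lambda>b. inf b a) ` B)"
    using B by (intro up_directed_image inf_mono) (auto simp: increases_to_def)
  then have "is_lub (j ` R ` (\<lambda>b. inf b a) ` B) (j (R a))"
    by (intro j_lub R.lub lub)
  then show ?thesis
  proof (rule is_lub_least)
    fix c assume "c \<in> j ` R ` (\<lambda>b. inf b a) ` B"
    then obtain b where b: "b \<in> B" "c = j (R (inf b a))" by auto
    have "c \<le> j (R b)" unfolding b j_le_iff by (rule R.mono) simp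
    then show "c \<le> u" using u[OF b(1)] by (rule order_trans)
  qed
qed

lemma sup_ext_eqI:
  assumes R: "positive_order_continuous R"
    and A: "increases_to j A x" and y: "is_lub (j ` R ` A) y"
  shows "sup_ext j R x = y"
  unfolding sup_ext_def
proof (rule the_equality)
  show "\<exists>A. increases_to j A x \<and> is_sup_in UNIV (j ` R ` A) y" using A y by blast
  fix y' assume "\<exists>A. increases_to j A x \<and> is_sup_in UNIV (j ` R ` A) y'"
  then obtain B where B: "increases_to j B x" "is_lub (j ` R ` B) y'" by blast
  have By: "j (R b) \<le> y'" if "b \<in> B" for b
    by (rule is_lub_upper[OF B(2)]) (use that in blast)
  have Ay: "j (R a) \<le> y" if "a \<in> A" for a
    by (rule is_lub_upper[OF y]) (use that in blast)
  have "j (R a) \<le> y'" if "a \<in> A" for a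
    by (rule sup_ext_mono_aux[OF R A B(1) By that])
  then have "y \<le> y'" by (intro is_lub_least[OF y]) auto
  moreover have "j (R b) \<le> y" if "b \<in> B" for b
    by (rule sup_ext_mono_aux[OF R B(1) A Ay that])
  then have "y' \<le> y" by (intro is_lub_least[OF B(2)]) auto
  ultimately show "y' = y" by simp
qed

lemma sup_ext_add:
  assumes R: "positive_order_continuous R"
    and A: "increases_to j A x" "is_lub (j ` R ` A) x'"
    and B: "increases_to j B y" "is_lub (j ` R ` B) y'"
  defines "C \<equiv> (\<lambda>(a, b). a + b) ` (A \<times> B)"
  shows "increases_to j C (x + y)" "is_lub (j ` R ` C) (x' + y')" "sup_ext j R (x + y) = x' + y'"
proof -
  interpret R: positive_order_continuous R by fact
  show *: "increases_to j C (x + y)"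
    unfolding increases_to_def
  proof (intro conjI)
    show "\<forall>a\<in>C. 0 \<le> a" using A B by (auto simp: C_def increases_to_def)
    show "up_directed C"
      unfolding up_directed_def
    proof (intro conjI ballI)
      show "C \<noteq> {}" using A B by (auto simp: C_def increases_to_def up_directed_def)
      fix p q assume "p \<in> C" "q \<in> C"
      then obtain a b a' b' where ab: "a \<in> A" "b \<in> B" "a' \<in> A" "b' \<in> B" "p = a + b" "q = a' + b'"
        by (auto simp: C_def)
      obtain a'' where a'': "a'' \<in> A" "a \<le> a''" "a' \<le> a''"
        using A(1) ab unfolding increases_to_def up_directed_def by blast
      obtain b'' where b'': "b'' \<in> B" "b \<le> b''" "b' \<le> b''"
        using B(1) ab unfolding increases_to_def up_directed_def by blast
      show "\<exists>z\<in>C. p \<le> z \<and> q \<le> z"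
        using a'' b'' ab by (intro bexI[of _ "a'' + b''"]) (auto simp: C_def intro!: add_mono)
    qed
    have "is_lub ((\<lambda>(a, b). j a + j b) ` (A \<times> B)) (x + y)"
      using A B by (intro is_lub_add_Times) (auto simp: increases_to_def)
    then show "is_lub (j ` C) (x + y)"
      unfolding C_def by (simp add: image_image case_prod_unfold j_add)
  qed
  have "is_lub ((\<lambda>(a, b). j (R a) + j (R b)) ` (A \<times> B)) (x' + y')"
    using A B by (intro is_lub_add_Times) (auto simp: image_image)
  then show "is_lub (j ` R ` C) (x' + y')"
    unfolding C_def by (simp add: image_image case_prod_unfold j_add R.add)
  then show "sup_ext j R (x + y) = x' + y'" by (rule sup_ext_eqI[OF R *])
qed

lemma increases_to_const: "0 \<le> a \<Longrightarrow> increases_to j {a} (j a)"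
  unfolding increases_to_def up_directed_def by (auto intro: is_lubI)

end

section \<open>The cone of integrable elements and the extended operators\<close>

locale ce_completion = ce_system T S e + riesz_completion j
  for T S :: "'a::dedekind_complete_riesz_space \<Rightarrow> 'a" and e :: 'a
    and j :: "'a \<Rightarrow> 'u::universally_complete_riesz_space"
begin

abbreviation "Tx \<equiv> sup_ext j T"
abbreviation "Sx \<equiv> sup_ext j S"

definition L1_net :: "'a set \<Rightarrow> 'u \<Rightarrow> bool" where
  "L1_net A u \<longleftrightarrow> increases_to j A u \<and> bdd_above (j ` T ` A)"

lemma L1_net_lub: "L1_net A u \<Longrightarrow> is_lub (j ` A) u"
  and L1_net_dir: "L1_net A u \<Longrightarrow> up_directed A"
  and L1_net_pos: "L1_net A u \<Longrightarrow> a \<in> A \<Longrightarrow> 0 \<le> a"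
  and L1_net_inc: "L1_net A u \<Longrightarrow> increases_to j A u"
  and L1_net_bdd: "L1_net A u \<Longrightarrow> bdd_above (j ` T ` A)"
  and L1_net_ne: "L1_net A u \<Longrightarrow> A \<noteq> {}"
  by (auto simp: L1_net_def increases_to_def up_directed_def)

lemma L1_net_nonneg: "L1_net A u \<Longrightarrow> 0 \<le> u"
  by (metis L1_net_lub L1_net_ne L1_net_pos ex_in_conv image_eqI is_lub_upper j_pos_iff order_trans)

lemma L1_cone_iff: "u \<in> L1_cone j T \<longleftrightarrow> (\<exists>A. L1_net A u)"
proof
  assume "u \<in> L1_cone j T"
  then show "\<exists>A. L1_net A u" by (auto simp: L1_cone_def L1_net_def)
next
  assume "\<exists>A. L1_net A u"
  then obtain A where A: "L1_net A u" by blast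
  have "bdd_below (j ` T ` A)"
    using L1_net_pos[OF A] by (intro bdd_belowI[of _ 0]) (auto simp: j_pos_iff intro!: T.pos)
  then show "u \<in> L1_cone j T" using A L1_net_nonneg[OF A] by (auto simp: L1_cone_def L1_net_def)
qed

lemma Tx_lub:
  assumes "L1_net A u"
  shows "is_lub (j ` T ` A) (Tx u)"
proof -
  have *: "is_lub (j ` T ` A) (Sup (j ` T ` A))"
    using L1_net_ne[OF assms] L1_net_bdd[OF assms] by (intro is_lub_Sup) auto
  then show ?thesis
    using sup_ext_eqI[OF T.positive_order_continuous_axioms L1_net_inc[OF assms] *] by simp
qed

lemma Tx_upper: "L1_net A u \<Longrightarrow> a \<in> A \<Longrightarrow> j (T a) \<le> Tx u"
  by (rule is_lub_upper[OF Tx_lub]) auto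

lemma Tx_nonneg: "L1_net A u \<Longrightarrow> 0 \<le> Tx u"
  by (metis L1_net_ne L1_net_pos Tx_upper T.pos ex_in_conv j_pos_iff order_trans)

text \<open>As \<open>T S = T\<close>, the band on which \<open>S ` A\<close> is unbounded is null.\<close>

lemma S_bdd:
  assumes A: "L1_net A u"
  shows "bdd_above (j ` S ` A)"
proof (rule universally_complete_bdd_above[OF weak_unit_j[OF e_unit]])
  show "0 \<le> x" if "x \<in> j ` S ` A" for x
    using that L1_net_pos[OF A] by (auto simp: j_pos_iff intro!: S.pos)
  fix l assume l: "\<And>m::nat. m > 0 \<Longrightarrow> l \<le> Sup ((\<lambda>x. inf ((1 / real m) *\<^sub>R x) (j e)) ` j ` S ` A)"
  let ?f = "\<lambda>m::nat. \<lambda>a. inf ((1 / real m) *\<^sub>R S a) e"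
  \<comment> \<open>The truncated suprema are formed in E so that \<open>T\<close> can act on them;
    \<open>T (S a) = T a\<close> bounds \<open>T (P m)\<close> by \<open>Tx u / m\<close>.\<close>
  define P where "P m = Sup (?f m ` A)" for m
  have P_lub: "is_lub (?f m ` A) (P m)" for m
    unfolding P_def by (rule is_lub_Sup) (use L1_net_ne[OF A] in \<open>auto intro!: bdd_aboveI[of _ e]\<close>)
  have lP: "l \<le> j (P m)" if "m > 0" for m
  proof -
    have eq: "(\<lambda>x. inf ((1 / real m) *\<^sub>R x) (j e)) ` j ` S ` A = j ` ?f m ` A"
      by (simp add: image_image j_inf j_scale)
    have "is_lub (j ` ?f m ` A) (Sup (j ` ?f m ` A))"
      by (rule is_lub_Sup) (use L1_net_ne[OF A] in \<open>auto simp: j_le_iff intro!: bdd_aboveI[of _ "j e"]\<close>)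
    then have "Sup (j ` ?f m ` A) = j (P m)" using j_lub[OF P_lub] by (rule is_lub_unique)
    then show ?thesis using l[OF that] unfolding eq by (simp only:)
  qed
  have P0: "0 \<le> P m" for m
  proof -
    obtain a where a: "a \<in> A" using L1_net_ne[OF A] by auto
    have "0 \<le> ?f m a" using a L1_net_pos[OF A] e_pos by (auto intro!: S.pos scaleR_nonneg_nonneg)
    also have "\<dots> \<le> P m" using a by (intro is_lub_upper[OF P_lub]) auto
    finally show ?thesis .
  qed
  have lP': "sup l 0 \<le> j (P m)" if "m > 0" for m using lP[OF that] P0 by (simp add: j_pos_iff)
  obtain z where z: "0 \<le> z" "j z = sup l 0" by (rule j_ideal[OF _ lP'[of 1]]) auto
  have "j (T z) \<le> 0"
  proof (rule archimedean_div[of 1])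
    show "0 \<le> Tx u" by (rule Tx_nonneg[OF A])
    fix m :: nat assume m: "m > 0"
    have "up_directed (?f m ` A)"
      by (intro up_directed_image[OF L1_net_dir[OF A]] inf_mono scaleR_left_mono S.mono) auto
    then have "is_lub (j ` T ` ?f m ` A) (j (T (P m)))" by (intro j_lub T.lub P_lub)
    then have "j (T (P m)) \<le> (1 / real m) *\<^sub>R Tx u"
    proof (rule is_lub_least)
      fix c assume "c \<in> j ` T ` ?f m ` A"
      then obtain a where a: "a \<in> A" "c = j (T (?f m a))" by auto
      have "T (?f m a) \<le> T ((1 / real m) *\<^sub>R S a)" by (rule T.mono) simp
      then have "c \<le> (1 / real m) *\<^sub>R j (T a)" unfolding a by (simp add: T.scale T_S flip: j_scale j_le_iff)
      also have "\<dots> \<le> (1 / real m) *\<^sub>R Tx u" using Tx_upper[OF A a(1)] by (rule scaleR_left_mono) simp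
      finally show "c \<le> \<dots>" .
    qed
    moreover have "j (T z) \<le> j (T (P m))"
      using lP'[OF m] z unfolding j_le_iff by (intro T.mono) (simp flip: j_le_iff)
    ultimately show "j (T z) \<le> 0 + (1 / real m) *\<^sub>R Tx u" by simp
  qed
  then have "T z \<le> 0" using j_le_iff[of "T z" 0] by (simp add: j_0)
  then have "z = 0" using T_eq_0D z by blast
  then show "l \<le> 0" using z by (metis j_0 sup.cobounded1)
qed

lemma Sx_lub:
  assumes "L1_net A u"
  shows "is_lub (j ` S ` A) (Sx u)"
proof -
  have *: "is_lub (j ` S ` A) (Sup (j ` S ` A))"
    using L1_net_ne[OF assms] S_bdd[OF assms] by (intro is_lub_Sup) auto
  then show ?thesis
    using sup_ext_eqI[OF S.positive_order_continuous_axioms L1_net_inc[OF assms] *] by simp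
qed

lemma L1_net_S: "L1_net A u \<Longrightarrow> L1_net (S ` A) (Sx u)"
  using Sx_lub[of A u] L1_net_pos[of A u] up_directed_image[of A S] S.mono
  by (auto simp: L1_net_def increases_to_def image_image T_S intro: S.pos)

lemma L1_net_T: "L1_net A u \<Longrightarrow> L1_net (T ` A) (Tx u)"
  using Tx_lub[of A u] L1_net_pos[of A u] up_directed_image[of A T] T.mono
  by (auto simp: L1_net_def increases_to_def image_image T_T intro: T.pos)

lemma L1_net_const: "0 \<le> a \<Longrightarrow> L1_net {a} (j a)"
  by (simp add: L1_net_def increases_to_const)

lemma Tx_j: "0 \<le> a \<Longrightarrow> Tx (j a) = j (T a)"
  using Tx_lub[OF L1_net_const, of a] is_lub_unique[OF _ is_lub_singleton] by simp

lemma Sx_j: "0 \<le> a \<Longrightarrow> Sx (j a) = j (S a)"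
  using Sx_lub[OF L1_net_const, of a] is_lub_unique[OF _ is_lub_singleton] by simp

lemma Tx_add: "u \<in> L1_cone j T \<Longrightarrow> v \<in> L1_cone j T \<Longrightarrow> Tx (u + v) = Tx u + Tx v"
  unfolding L1_cone_iff using sup_ext_add(3)[OF T.positive_order_continuous_axioms]
  by (metis L1_net_inc Tx_lub)

lemma Sx_add: "u \<in> L1_cone j T \<Longrightarrow> v \<in> L1_cone j T \<Longrightarrow> Sx (u + v) = Sx u + Sx v"
  unfolding L1_cone_iff using sup_ext_add(3)[OF S.positive_order_continuous_axioms]
  by (metis L1_net_inc Sx_lub)

text \<open>Needed because \<open>S_ext\<close> works with the positive and negative part of
  \<open>u - v\<close>, which lie below \<open>u\<close> and \<open>v\<close> and must be seen to
  belong to the cone.\<close>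

lemma L1_cone_solid:
  assumes u: "u \<in> L1_cone j T" and x: "0 \<le> x" "x \<le> u"
  shows "x \<in> L1_cone j T"
proof -
  obtain A where A: "L1_net A u" using u L1_cone_iff by blast
  \<comment> \<open>Domination by members of \<open>A\<close> keeps the expectations below
    \<open>Tx u\<close>; closure under \<open>sup\<close> makes the set directed.\<close>
  define B where "B = {b. 0 \<le> b \<and> j b \<le> x \<and> (\<exists>a\<in>A. b \<le> a)}"
  have "L1_net B x"
    unfolding L1_net_def increases_to_def
  proof (intro conjI)
    show "\<forall>b\<in>B. 0 \<le> b" by (auto simp: B_def)
    show "up_directed B"
      unfolding up_directed_def
    proof (intro conjI ballI)
      have "0 \<in> B" using L1_net_ne[OF A] L1_net_pos[OF A] x by (auto simp: B_def j_0)
      then show "B \<noteq> {}" by auto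
      fix b b' assume b: "b \<in> B" "b' \<in> B"
      then obtain a a' where a: "a \<in> A" "a' \<in> A" "b \<le> a" "b' \<le> a'" by (auto simp: B_def)
      obtain c where c: "c \<in> A" "a \<le> c" "a' \<le> c"
        using L1_net_dir[OF A] a unfolding up_directed_def by blast
      have "sup b b' \<le> c" using a c by (meson le_supI order_trans)
      then have "sup b b' \<in> B" using b c(1) by (auto simp: B_def j_sup intro: le_supI1)
      then show "\<exists>z\<in>B. b \<le> z \<and> b' \<le> z" by (intro bexI[of _ "sup b b'"]) auto
    qed
    show "is_lub (j ` B) x"
    proof (rule is_lubI)
      fix v assume v: "\<And>b. b \<in> j ` B \<Longrightarrow> b \<le> v"
      have "is_lub ((\<lambda>y. inf y x) ` j ` A) x"
        using is_lub_inf[OF L1_net_lub[OF A], of x] x by (simp add: inf_absorb2)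
      then show "x \<le> v"
      proof (rule is_lub_least)
        fix c assume "c \<in> (\<lambda>y. inf y x) ` j ` A"
        then obtain a where a: "a \<in> A" "c = inf (j a) x" by auto
        have "0 \<le> c" "c \<le> j a" using a L1_net_pos[OF A] x by (auto simp: j_pos_iff)
        then obtain z where z: "0 \<le> z" "j z = c" by (rule j_ideal)
        have "j z \<le> j a" "j z \<le> x" using z a by auto
        then have "z \<in> B" using a(1) z(1) unfolding B_def j_le_iff by blast
        then show "c \<le> v" using v z by blast
      qed
    qed (auto simp: B_def)
    show "bdd_above (j ` T ` B)"
    proof (rule bdd_aboveI[of _ "Tx u"])
      fix c assume "c \<in> j ` T ` B"
      then obtain b a where "c = j (T b)" "b \<le> a" "a \<in> A" by (auto simp: B_def)
      then have "c \<le> j (T a)" by (simp add: j_le_iff T.mono)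
      then show "c \<le> Tx u" using Tx_upper[OF A \<open>a \<in> A\<close>] by (rule order_trans)
    qed
  qed
  then show ?thesis using L1_cone_iff by blast
qed

lemma L1_cone_nonneg: "u \<in> L1_cone j T \<Longrightarrow> 0 \<le> u"
  using L1_cone_iff L1_net_nonneg by blast

lemma Tx_cone: "u \<in> L1_cone j T \<Longrightarrow> Tx u \<in> L1_cone j T"
  using L1_cone_iff L1_net_T by blast

lemma T_ext_diff:
  assumes "u \<in> L1_cone j T" "v \<in> L1_cone j T"
  shows "T_ext j T (u - v) = Tx u - Tx v"
  unfolding T_ext_def
proof (rule the_equality)
  show "\<exists>u'\<in>L1_cone j T. \<exists>v'\<in>L1_cone j T. u - v = u' - v' \<and> Tx u - Tx v = Tx u' - Tx v'"
    using assms by blast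
  fix y assume "\<exists>u'\<in>L1_cone j T. \<exists>v'\<in>L1_cone j T. u - v = u' - v' \<and> y = Tx u' - Tx v'"
  then obtain u' v' where uv: "u' \<in> L1_cone j T" "v' \<in> L1_cone j T" "u - v = u' - v'" "y = Tx u' - Tx v'"
    by blast
  have "u + v' = u' + v" using uv(3) by (simp add: diff_eq_eq algebra_simps)
  then have "Tx u + Tx v' = Tx u' + Tx v" using assms uv by (simp flip: Tx_add)
  then have "Tx u - Tx v = Tx u' - Tx v'" by (simp only: diff_eq_eq diff_add_eq eq_diff_eq)
  then show "y = Tx u - Tx v" using uv(4) by simp
qed

lemma S_ext_diff:
  assumes "u \<in> L1_cone j T" "v \<in> L1_cone j T"
  shows "S_ext j S (u - v) = Sx u - Sx v"
proof -
  define p n where "p = sup (u - v) 0" and "n = sup (- (u - v)) 0"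
  have nn: "0 \<le> u" "0 \<le> v" using assms L1_cone_nonneg by auto
  have "u - v \<le> u" "- (u - v) \<le> v" using nn by auto
  then have "p \<in> L1_cone j T" "n \<in> L1_cone j T"
    using nn by (auto simp: p_def n_def simp del: minus_diff_eq
        intro: L1_cone_solid[OF assms(1)] L1_cone_solid[OF assms(2)])
  moreover have "p - n = u - v" unfolding p_def n_def by (rule pos_diff_neg)
  then have "p + v = u + n" by (simp add: algebra_simps)
  ultimately have "Sx p + Sx v = Sx u + Sx n" using assms by (simp flip: Sx_add)
  then have "Sx p - Sx n = Sx u - Sx v"
    by (simp only: diff_eq_eq diff_add_eq eq_diff_eq)
  then show ?thesis by (simp add: S_ext_def p_def n_def)
qed

lemma L1_cone_0: "0 \<in> L1_cone j T"
  using L1_cone_iff L1_net_const[of 0] by (auto simp: j_0)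

lemma S_ext_cone: "u \<in> L1_cone j T \<Longrightarrow> S_ext j S u = Sx u"
  using S_ext_diff[OF _ L1_cone_0, of u] Sx_j[of 0] by (simp add: j_0 S.zero)

lemma S_ext_pow_net: "L1_net A u \<Longrightarrow> L1_net ((S ^^ k) ` A) ((S_ext j S ^^ k) u)"
proof (induction k)
  case (Suc k)
  then have net: "L1_net ((S ^^ k) ` A) ((S_ext j S ^^ k) u)" by blast
  then have "S_ext j S ((S_ext j S ^^ k) u) = Sx ((S_ext j S ^^ k) u)"
    using S_ext_cone L1_cone_iff by blast
  with L1_net_S[OF net] show ?case by (simp add: image_comp)
qed simp

lemma S_ext_pow_diff:
  assumes "u \<in> L1_cone j T" "v \<in> L1_cone j T"
  shows "(S_ext j S ^^ k) (u - v) = (S_ext j S ^^ k) u - (S_ext j S ^^ k) v"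
proof (induction k)
  case (Suc k)
  have "(S_ext j S ^^ k) u \<in> L1_cone j T" "(S_ext j S ^^ k) v \<in> L1_cone j T"
    using assms S_ext_pow_net L1_cone_iff by blast+
  then show ?case using Suc by (simp add: S_ext_diff S_ext_cone)
qed simp

lemma cesaro_diff:
  "u \<in> L1_cone j T \<Longrightarrow> v \<in> L1_cone j T \<Longrightarrow> cesaro j S n (u - v) = cesaro j S n u - cesaro j S n v"
  by (simp add: cesaro_def S_ext_pow_diff sum_subtractf scaleR_diff_right)

lemma S_pow_mono: "a \<le> b \<Longrightarrow> (S ^^ k) a \<le> (S ^^ k) b"
  by (induction k) (auto intro: S.mono)

lemma birkhoff_avg_mono: "a \<le> b \<Longrightarrow> birkhoff_avg S n a \<le> birkhoff_avg S n b"
  unfolding birkhoff_avg_def birkhoff_sum_def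
  by (intro scaleR_left_mono sum_mono S_pow_mono) auto

text \<open>Reduces estimates of averages in the universal completion to averages of elements of E,
  where the maximal inequality holds.\<close>

lemma cesaro_lub:
  assumes A: "L1_net A u" and n: "0 < n"
  shows "is_lub ((\<lambda>a. j (birkhoff_avg S n a)) ` A) (cesaro j S n u)"
proof -
  have "is_lub ((\<lambda>a. j (birkhoff_sum S n a)) ` A) (\<Sum>k<n. (S_ext j S ^^ k) u)"
  proof (induction n)
    case 0
    then show ?case
      using L1_net_ne[OF A] is_lub_singleton[of 0]
      by (simp add: birkhoff_sum_def j_0 image_constant_conv)
  next
    case (Suc n)
    have "is_lub ((\<lambda>a. j (birkhoff_sum S n a) + j ((S ^^ n) a)) ` A)
      ((\<Sum>k<n. (S_ext j S ^^ k) u) + (S_ext j S ^^ n) u)"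
    proof (rule is_lub_add[OF L1_net_dir[OF A] Suc])
      show "is_lub ((\<lambda>a. j ((S ^^ n) a)) ` A) ((S_ext j S ^^ n) u)"
        using L1_net_lub[OF S_ext_pow_net[OF A]] by (simp add: image_image)
    qed (auto simp: j_le_iff birkhoff_sum_def intro: S_pow_mono sum_mono)
    then show ?case by (simp add: birkhoff_sum_def j_add)
  qed
  from is_lub_scaleR[OF this, of "1 / real n"] n show ?thesis
    by (simp add: image_image cesaro_def birkhoff_avg_def j_scale)
qed

subsection \<open>Convergence on the cone\<close>

text \<open>For \<open>a\<close> in \<open>A\<close> the error is that of \<open>a\<close>, handled
  by \<open>birkhoff_avg_uo\<close>, plus the remainders of \<open>cesaro\<close> and
  \<open>Tx\<close> at \<open>a\<close>. The remainders are bounded uniformly in time by some \<rho>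
  in E, small only in the sense that \<open>T \<rho>\<close> is; hence the lower bound is pulled
  back to \<open>z\<close> and only \<open>T z \<le> 0\<close> is proved.\<close>

lemma cesaro_converges:
  assumes erg: "ergodic T S" and A: "L1_net A u"
  shows "order_converges (\<lambda>n. cesaro j S n u) (Tx u) sequentially"
proof (rule uo_imp_order_converges[OF weak_unit_j[OF e_unit]])
  let ?d = "\<lambda>k. inf \<bar>cesaro j S k u - Tx u\<bar> (j e)"
  define Q where "Q n = Sup (?d ` {n..})" for n
  fix l assume l: "\<And>n. l \<le> Sup (?d ` {n..})"
  have je: "0 \<le> j e" using e_pos by (simp add: j_pos_iff)
  have Q_lub: "is_lub (?d ` {n..}) (Q n)" for n
    unfolding Q_def by (rule is_lub_Sup) (auto intro!: bdd_aboveI[of _ "j e"])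
  have Q0: "0 \<le> Q n" for n
  proof -
    have "0 \<le> ?d n" using je by simp
    also have "\<dots> \<le> Q n" by (rule is_lub_upper[OF Q_lub]) auto
    finally show ?thesis .
  qed
  have lQ: "sup l 0 \<le> Q n" for n using l[of n] Q0 by (simp add: Q_def)
  have "Q 0 \<le> j e" by (rule is_lub_least[OF Q_lub]) auto
  with lQ[of 0] have "sup l 0 \<le> j e" by (rule order_trans)
  then obtain z where z: "0 \<le> z" "j z = sup l 0" by (rule j_ideal[rotated]) auto
  have "j (T z) \<le> 0"
  proof (rule archimedean_eps)
    fix \<epsilon> :: real assume eps: "0 < \<epsilon>"
    define \<delta> where "\<delta> = \<epsilon> / 2"
    have \<delta>: "0 < \<delta>" "\<epsilon> = \<delta> + \<delta>" using eps by (auto simp: \<delta>_def)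
    have \<delta>e: "0 \<le> \<delta> *\<^sub>R e" using \<delta> e_pos by (simp add: scaleR_nonneg_nonneg)
    \<comment> \<open>The summand \<open>1 / \<delta>\<close> comes from the maximal inequality for
      \<open>b - a\<close>, the summand 1 from the term \<open>T (b - a)\<close> itself.\<close>
    define \<kappa> where "\<kappa> = 1 / \<delta> + 1"
    have \<kappa>: "0 < \<kappa>" using \<delta> by (auto simp: \<kappa>_def intro: add_pos_pos)
    have main: "j (T z) - \<epsilon> *\<^sub>R j e \<le> \<kappa> *\<^sub>R (Tx u - j (T a))" if a: "a \<in> A" for a
    proof -
      \<comment> \<open>Letting \<open>N\<close> range over all times makes the supremum \<rho> a
        bound for every average at once; the truncation at \<open>e\<close> guarantees that it
        exists in E.\<close>
      let ?h = "\<lambda>(N, b). inf (hopf_max S N (b - a - \<delta> *\<^sub>R e) + T (b - a)) e"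
      define D where "D = ?h ` (UNIV \<times> {b \<in> A. a \<le> b})"
      define \<rho> where "\<rho> = Sup D"
      have \<rho>_lub: "is_lub D \<rho>"
        unfolding \<rho>_def by (rule is_lub_Sup) (use a in \<open>auto simp: D_def intro!: bdd_aboveI[of _ e]\<close>)
      have D_dir: "up_directed D"
        unfolding up_directed_def
      proof (intro conjI ballI)
        show "D \<noteq> {}" using a by (auto simp: D_def)
        fix x y assume "x \<in> D" "y \<in> D"
        then obtain N b N' b' where b: "b \<in> A" "a \<le> b" "b' \<in> A" "a \<le> b'"
          "x = ?h (N, b)" "y = ?h (N', b')" by (auto simp: D_def)
        obtain c where c: "c \<in> A" "b \<le> c" "b' \<le> c"
          using L1_net_dir[OF A] b unfolding up_directed_def by blast
        have mono: "?h (N, b) \<le> ?h (M, c)" if "N \<le> M" "b \<le> c" for N M b c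
        proof -
          have "hopf_max S N (b - a - \<delta> *\<^sub>R e) \<le> hopf_max S M (c - a - \<delta> *\<^sub>R e)"
            by (rule order_trans[OF hopf_max_mono hopf_max_mono2]) (use that in auto)
          moreover have "T (b - a) \<le> T (c - a)" using that by (intro T.mono) simp
          ultimately show ?thesis unfolding case_prod_conv by (intro inf_mono add_mono order_refl)
        qed
        have "?h (max N N', c) \<in> D" using b c unfolding D_def by (intro imageI) auto
        moreover have "x \<le> ?h (max N N', c)" "y \<le> ?h (max N N', c)"
          unfolding b(5,6) using c by (intro mono; simp)+
        ultimately show "\<exists>z\<in>D. x \<le> z \<and> y \<le> z" by blast
      qed
      have T\<rho>: "j (T \<rho>) \<le> \<kappa> *\<^sub>R (Tx u - j (T a))"
      proof (rule is_lub_least[OF j_lub[OF T.lub[OF D_dir \<rho>_lub]]])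
        fix x assume "x \<in> j ` T ` D"
        then obtain N b where b: "b \<in> A" "a \<le> b" and x: "x = j (T (?h (N, b)))" by (auto simp: D_def)
        let ?G = "hopf_max S N (b - a - \<delta> *\<^sub>R e)"
        have Tba: "0 \<le> T (b - a)" using b by (auto intro: T.pos)
        have "?h (N, b) \<le> inf ?G e + inf (T (b - a)) e"
          using inf_add_le[OF e_pos hopf_max_pos Tba] by simp
        also have "\<dots> \<le> inf ?G e + T (b - a)" by (intro add_mono) auto
        finally have "T (?h (N, b)) \<le> T (inf ?G e + T (b - a))" by (rule T.mono)
        also have "\<dots> = T (inf ?G e) + T (b - a)" by (simp add: T.add T_T)
        also have "\<dots> \<le> (1 / \<delta>) *\<^sub>R T (b - a) + T (b - a)"
          using scaleR_left_mono[OF hopf_maximal[of "b - a" \<delta> N], of "1 / \<delta>"] b \<delta> by simp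
        also have "(1 / \<delta>) *\<^sub>R T (b - a) + T (b - a) = \<kappa> *\<^sub>R T (b - a)"
          by (simp add: \<kappa>_def scaleR_add_left)
        finally have "x \<le> \<kappa> *\<^sub>R (j (T b) - j (T a))"
          by (simp add: x T.diff flip: j_diff j_scale j_le_iff)
        also have "\<dots> \<le> \<kappa> *\<^sub>R (Tx u - j (T a))"
          using Tx_upper[OF A b(1)] \<kappa> by (intro scaleR_left_mono diff_right_mono) auto
        finally show "x \<le> \<dots>" .
      qed
      obtain r where r: "\<And>m n. m \<le> n \<Longrightarrow> r n \<le> r m" "\<And>l. (\<And>n. l \<le> r n) \<Longrightarrow> l \<le> 0"
        "\<And>n. inf \<bar>birkhoff_avg S (Suc n) a - T a\<bar> e \<le> \<delta> *\<^sub>R e + r n"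
        using birkhoff_avg_uo[OF erg \<delta>(1), of a] by metis
      \<comment> \<open>The shift to \<open>Suc m\<close> matches \<open>birkhoff_avg_uo\<close>,
        where \<open>r n\<close> belongs to the average of length \<open>Suc n\<close>, and keeps
        all lengths positive.\<close>
      have Q_le: "Q (Suc m) \<le> j ((\<delta> *\<^sub>R e + r m) + (\<delta> *\<^sub>R e + \<rho>))" for m
      proof (rule is_lub_least[OF Q_lub])
        fix x assume "x \<in> ?d ` {Suc m..}"
        then obtain i where i: "Suc m \<le> i" "x = ?d i" by auto
        then obtain k' where "i = Suc k'" by (cases i) auto
        with i have k': "m \<le> k'" and x: "x = ?d (Suc k')" by auto
        define k where "k = Suc k'"
        let ?c = "j (birkhoff_avg S k a) + j (T a)"
        \<comment> \<open>Both remainders are nonnegative and increase along the same directed set,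
          so their sum is a single supremum over \<open>A\<close> and can be truncated as one
          element.\<close>
        let ?P = "cesaro j S k u + Tx u - ?c"
        have lub: "is_lub ((\<lambda>b. j (birkhoff_avg S k b) + j (T b)) ` A) (cesaro j S k u + Tx u)"
          using Tx_lub[OF A]
          by (intro is_lub_add[OF L1_net_dir[OF A]] cesaro_lub[OF A])
            (auto simp: image_image k_def j_le_iff intro: birkhoff_avg_mono T.mono)
        have P0: "0 \<le> ?P" using is_lub_upper[OF lub] a by simp
        have "is_lub ((\<lambda>x. inf x (j e)) ` (\<lambda>x. x + (- ?c)) `
            (\<lambda>b. j (birkhoff_avg S k b) + j (T b)) ` A) (inf ((cesaro j S k u + Tx u) + (- ?c)) (j e))"
          by (intro is_lub_inf is_lub_add_const lub)
        then have P: "inf ((cesaro j S k u + Tx u) + (- ?c)) (j e) \<le> j (\<delta> *\<^sub>R e + \<rho>)"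
        proof (rule is_lub_least)
          fix y assume "y \<in> (\<lambda>x. inf x (j e)) ` (\<lambda>x. x + (- ?c)) `
            (\<lambda>b. j (birkhoff_avg S k b) + j (T b)) ` A"
          then obtain b' where b': "b' \<in> A"
            "y = inf ((j (birkhoff_avg S k b') + j (T b')) + (- ?c)) (j e)" by auto
          obtain b where b: "b \<in> A" "a \<le> b" "b' \<le> b"
            using L1_net_dir[OF A] a b'(1) unfolding up_directed_def by blast
          let ?G = "hopf_max S k (b - a - \<delta> *\<^sub>R e)"
          have ba: "birkhoff_avg S k b - birkhoff_avg S k a = birkhoff_avg S k (b - a)"
            by (simp add: birkhoff_avg_def birkhoff_sum_diff scaleR_diff_right)
          have "birkhoff_avg S k (b - a) - \<delta> *\<^sub>R e \<le> (1 / real k) *\<^sub>R ?G"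
            by (rule birkhoff_avg_le_hopf_max) (auto simp: S.scale S_e k_def)
          \<comment> \<open>Dropping \<open>1 / k\<close> is harmless: smallness of this term comes
            from \<open>a\<close> being close to \<open>u\<close>, not from time.\<close>
          also have "\<dots> \<le> 1 *\<^sub>R ?G" using hopf_max_pos by (intro scaleR_right_mono) (auto simp: k_def)
          finally have G: "birkhoff_avg S k (b - a) \<le> \<delta> *\<^sub>R e + ?G" by (simp add: diff_le_eq add.commute)
          have Tba: "0 \<le> T (b - a)" using b by (auto intro: T.pos)
          have "y \<le> inf ((j (birkhoff_avg S k b) + j (T b)) + (- ?c)) (j e)"
            unfolding b'(2) using b
            by (intro inf_mono add_mono order_refl) (simp_all add: j_le_iff birkhoff_avg_mono T.mono)
          also have "(j (birkhoff_avg S k b) + j (T b)) + (- ?c)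
              = j ((birkhoff_avg S k b - birkhoff_avg S k a) + (T b - T a))"
            by (simp add: j_add j_diff)
          also have "inf \<dots> (j e) = j (inf (birkhoff_avg S k (b - a) + T (b - a)) e)"
            by (simp add: j_inf ba T.diff)
          also have "\<dots> \<le> j (inf (\<delta> *\<^sub>R e + (?G + T (b - a))) e)"
            unfolding j_le_iff using add_right_mono[OF G, of "T (b - a)"]
            by (intro inf_mono) (simp_all add: add.assoc)
          also have "\<dots> \<le> j (inf (\<delta> *\<^sub>R e) e + inf (?G + T (b - a)) e)"
            unfolding j_le_iff
            by (intro inf_add_le e_pos \<delta>e add_nonneg_nonneg hopf_max_pos Tba)
          also have "\<dots> \<le> j (\<delta> *\<^sub>R e + \<rho>)"
          proof -
            have "inf (?G + T (b - a)) e \<in> D" using b unfolding D_def by force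
            then show ?thesis unfolding j_le_iff by (intro add_mono is_lub_upper[OF \<rho>_lub]) auto
          qed
          finally show "y \<le> j (\<delta> *\<^sub>R e + \<rho>)" .
        qed
        have ca: "0 \<le> cesaro j S k u - j (birkhoff_avg S k a)"
          using is_lub_upper[OF cesaro_lub[OF A, of k]] a by (auto simp: k_def)
        have ta: "0 \<le> Tx u - j (T a)" using Tx_upper[OF A a] by simp
        have "cesaro j S k u - Tx u = (j (birkhoff_avg S k a) - j (T a))
            + ((cesaro j S k u - j (birkhoff_avg S k a)) - (Tx u - j (T a)))"
          by (simp add: algebra_simps)
        also have "\<bar>\<dots>\<bar> \<le> \<bar>j (birkhoff_avg S k a) - j (T a)\<bar>
            + (\<bar>cesaro j S k u - j (birkhoff_avg S k a)\<bar> + \<bar>Tx u - j (T a)\<bar>)"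
          by (rule order_trans[OF abs_triangle_ineq add_left_mono[OF abs_triangle_ineq4]])
        also have "\<dots> = j \<bar>birkhoff_avg S k a - T a\<bar> + ?P"
          using ca ta by (simp add: j_abs j_diff)
        finally have "x \<le> inf (j \<bar>birkhoff_avg S k a - T a\<bar> + ?P) (j e)"
          unfolding x k_def[symmetric] by (rule inf_mono) simp
        also have "\<dots> \<le> inf (j \<bar>birkhoff_avg S k a - T a\<bar>) (j e) + inf ?P (j e)"
          by (rule inf_add_le[OF je _ P0]) (simp add: j_pos_iff)
        also have "\<dots> \<le> j (\<delta> *\<^sub>R e + r m) + j (\<delta> *\<^sub>R e + \<rho>)"
        proof (rule add_mono)
          have "inf \<bar>birkhoff_avg S k a - T a\<bar> e \<le> \<delta> *\<^sub>R e + r k'" unfolding k_def by (rule r(3))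
          also have "\<dots> \<le> \<delta> *\<^sub>R e + r m" using r(1)[OF k'] by simp
          finally show "inf (j \<bar>birkhoff_avg S k a - T a\<bar>) (j e) \<le> j (\<delta> *\<^sub>R e + r m)"
            by (simp add: j_le_iff flip: j_inf)
        qed (use P in \<open>simp only: diff_conv_add_uminus\<close>)
        finally show "x \<le> j ((\<delta> *\<^sub>R e + r m) + (\<delta> *\<^sub>R e + \<rho>))" by (simp only: j_add)
      qed
      have "z - (\<epsilon> *\<^sub>R e + \<rho>) \<le> r m" for m
      proof -
        have "j z \<le> j ((\<delta> *\<^sub>R e + r m) + (\<delta> *\<^sub>R e + \<rho>))"
          unfolding z(2) using lQ Q_le order_trans by blast
        then have "z \<le> (\<delta> *\<^sub>R e + r m) + (\<delta> *\<^sub>R e + \<rho>)" by (simp only: j_le_iff)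
        also have "\<dots> = r m + (\<epsilon> *\<^sub>R e + \<rho>)"
          unfolding \<delta>(2) scaleR_add_left by (simp only: ac_simps)
        finally show ?thesis by (simp only: diff_le_eq)
      qed
      then have "z - (\<epsilon> *\<^sub>R e + \<rho>) \<le> 0" by (rule r(2))
      then have "z \<le> \<epsilon> *\<^sub>R e + \<rho>" by simp
      then have "T z \<le> T (\<epsilon> *\<^sub>R e + \<rho>)" by (rule T.mono)
      also have "\<dots> = \<epsilon> *\<^sub>R e + T \<rho>" by (simp add: T.add T.scale T_e)
      finally have "j (T z) \<le> j (\<epsilon> *\<^sub>R e + T \<rho>)" by (simp only: j_le_iff)
      also have "\<dots> = \<epsilon> *\<^sub>R j e + j (T \<rho>)" by (simp add: j_add j_scale)
      also have "\<dots> \<le> \<epsilon> *\<^sub>R j e + \<kappa> *\<^sub>R (Tx u - j (T a))" using T\<rho> by (rule add_left_mono)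
      finally show ?thesis by (simp add: diff_le_eq add.commute)
    qed
    \<comment> \<open>Since \<kappa> does not depend on \<open>a\<close>, dividing by it leaves a
      lower bound of all \<open>Tx u - j (T a)\<close>, whose infimum is 0.\<close>
    have "(1 / \<kappa>) *\<^sub>R (j (T z) - \<epsilon> *\<^sub>R j e) \<le> 0"
    proof (rule is_lub_diff_dn[OF Tx_lub[OF A]])
      fix y assume "y \<in> j ` T ` A"
      then obtain a where a: "a \<in> A" "y = j (T a)" by auto
      show "(1 / \<kappa>) *\<^sub>R (j (T z) - \<epsilon> *\<^sub>R j e) \<le> Tx u - y"
        using scaleR_left_mono[OF main[OF a(1)], of "1 / \<kappa>"] \<kappa> a(2) by simp
    qed
    from scaleR_left_mono[OF this, of \<kappa>] \<kappa> have "j (T z) - \<epsilon> *\<^sub>R j e \<le> 0" by simp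
    then show "j (T z) \<le> 0 + \<epsilon> *\<^sub>R j e" by simp
  qed (rule je)
  then have "T z \<le> 0" using j_le_iff[of "T z" 0] by (simp add: j_0)
  then have "z = 0" using T_eq_0D z by blast
  then show "l \<le> 0" using z by (metis j_0 sup.cobounded1)
qed

section \<open>The two implications\<close>

lemma ergodic_imp_has_LS:
  assumes "ergodic T S" and f: "f \<in> L1 j T"
  shows "has_LS j T S f (T_ext j T f)"
proof -
  obtain u v where uv: "f = u - v" "u \<in> L1_cone j T" "v \<in> L1_cone j T"
    using f by (auto simp: L1_def)
  obtain A B where "L1_net A u" "L1_net B v" using uv L1_cone_iff by auto
  then have "order_converges (\<lambda>n. cesaro j S n u - cesaro j S n v) (Tx u - Tx v) sequentially"
    by (intro order_converges_diff cesaro_converges[OF assms(1)])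
  then have "order_converges (\<lambda>n. cesaro j S n f) (T_ext j T f) sequentially"
    using uv by (simp add: cesaro_diff T_ext_diff)
  moreover have "T_ext j T f \<in> L1 j T"
    using uv Tx_cone by (auto simp: T_ext_diff L1_def)
  ultimately show ?thesis by (simp add: has_LS_def)
qed

lemma has_LS_imp_ergodic:
  assumes L: "\<forall>f\<in>L1 j T. has_LS j T S f (T_ext j T f)"
  shows "ergodic T S"
  unfolding ergodic_def
proof (intro allI impI)
  fix f assume f: "S f = f"
  let ?p = "sup f 0" and ?n = "sup (- f) 0"
  have pn: "j ?p \<in> L1_cone j T" "j ?n \<in> L1_cone j T"
    using L1_net_const L1_cone_iff by (meson sup.cobounded2)+
  have jf: "j f = j ?p - j ?n" by (simp only: pos_diff_neg flip: j_diff)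
  have "T_ext j T (j f) = j (T ?p) - j (T ?n)" unfolding jf by (simp add: T_ext_diff[OF pn] Tx_j)
  also have "\<dots> = j (T f)" by (simp only: pos_diff_neg flip: j_diff T.diff)
  finally have Tf: "T_ext j T (j f) = j (T f)" .
  have "S_ext j S (j f) = j (S ?p) - j (S ?n)" unfolding jf by (simp add: S_ext_diff[OF pn] Sx_j)
  also have "\<dots> = j f" by (simp only: pos_diff_neg f flip: j_diff S.diff)
  finally have Sf: "S_ext j S (j f) = j f" .
  have pow: "(S_ext j S ^^ k) (j f) = j f" for k by (induction k) (simp_all add: Sf)
  \<comment> \<open>At \<open>n = 0\<close> the average is 0 by convention, so the sequence is
    constant only from 1 on.\<close>
  have "cesaro j S n (j f) = j f" if "n > 0" for n
    using that by (simp add: cesaro_def pow sum_constant_scaleR)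
  then have "\<forall>\<^sub>F n in sequentially. cesaro j S n (j f) = j f"
    using eventually_gt_at_top by (rule eventually_mono[rotated])
  moreover have "j f \<in> L1 j T" using pn jf by (auto simp: L1_def)
  then have "order_converges (\<lambda>n. cesaro j S n (j f)) (j (T f)) sequentially"
    using L Tf by (metis has_LS_def)
  ultimately have "j (T f) = j f" by (intro order_converges_eventually_const) auto
  then show "T f = f" by (simp add: j_inj)
qed

end

theorem theorem10:
  fixes T S :: "'a::dedekind_complete_riesz_space \<Rightarrow> 'a"
    and e :: 'a
    and j :: "'a \<Rightarrow> 'u::universally_complete_riesz_space"
  assumes "ce_preserving_system T S e"
    and "universal_completion j"
  shows "ergodic T S \<longleftrightarrow> (\<forall>f\<in>L1 j T. has_LS j T S f (T_ext j T f))"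
proof -
  interpret ce_completion T S e j
    by (intro ce_completion.intro ce_system.intro riesz_completion.intro assms)
  show ?thesis using ergodic_imp_has_LS has_LS_imp_ergodic by blast
qed

end
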